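(* There is an equilibrium for the Ring Partition problem for any prior $\sigma$ on $n$ with any support, including an infinite support.
   Context: **Network and agents.** The network is a bidirectional ring with an even number $n$ of nodes ($n$ always denotes the actual number of nodes). Each node is an agent with unlimited computational power. Agents communicate over edges in synchronous rounds and all start at round $0$. Initially each agent knows its own id and private input (including its preference), but not those of other agents. Private information comes from a finite set, and each agent's prior over the private information of the others is uniform. The agents do not know $n$ but know a prior $\sigma$ on $\mathbb{N}$ with $n\sim\sigma$. The prior has *infinite support* if there is $n_0$ such that $\Pr[n=x]>0$ for all $x>n_0$. **Outputs and utilities.** Agent $a$ outputs $o_a$ ($\bot$ means it aborts). Output vectors are $O=(o_1,\dots,o_n)\in\Theta=\Theta_L\sqcup\Theta_E$, where $\Theta_L$ is the set of legal and $\Theta_E$ the set of erroneous output vectors. Each agent $a$ has a single preferred output value $p_a$ and utility $u_a(O)=1$ if $o_a=p_a$ and $O\in\Theta_L$, and $u_a(O)=0$ otherwise. An agent that detects that another agent deviated outputs $\bot$, which makes the output erroneous. **Equilibrium.** For a step $s$ (the entire operation of an agent in one round) of agent $a$ at round $r$ of an execution, $\mathbb{E}_{s,r}[u_a]=\sum_{O\in\Theta}x_O(s,r)u_a(O)$, where $x_O(s,r)$ is the probability, estimated by $a$ at round $r$, that $O$ is output if $a$ takes step $s$ and all other agents follow the algorithm. An algorithm $\Lambda$ whose next step at round $r$ is $s(r)$ is a (distributed) equilibrium if for every agent $a$, every round $r$ of every possible execution in which all steps up to round $r$ were according to $\Lambda$, and every deviating step $\bar s$: $\mathbb{E}_{s(r),r}[u_a]\ge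 \mathbb{E}_{\bar s,r}[u_a]$. Only a single agent deviates (no coalitions). An "equilibrium for a problem" is an algorithm solving the problem that is an equilibrium. **Duplication (Sybil attack).** A deviating agent may pretend to be $d$ agents, by simulating $d$ imaginary agents with fake ids and distributing its edges among them. The other agents then execute the algorithm as if on the enlarged ring, of size $n+d-1$. Fake id collisions are disregarded. The cheater still produces a single output, and legality is judged on the output vector of the $n$ real agents. **Ring Partition.** The agents of an even-sized ring must be partitioned into two equally-sized groups, group $0$ and group $1$ (each agent outputs its group; the output is legal iff exactly $n/2$ agents output $0$ and $n/2$ output $1$). An agent prefers to belong to either group $0$ or group $1$. *)

theory Defs
  imports "HOL-Probability.Probability"
begin

section \<open>Agents\<close>

text \<open>
  A message is a finite string of numbers; the empty string means that nothing is sent.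
  Each agent has two ports, named by the Booleans, one for each of its edges.
  An output is a group (\<^term>\<open>False\<close> is group 0, \<^term>\<open>True\<close> is group 1) or abort
  (\<^term>\<open>None\<close>).
\<close>

type_synonym msg = "nat list"
type_synonym port = bool
type_synonym agent_output = "bool option"

text \<open>What an agent does in one round. The component \<open>draw\<close> is private: it records random
  draws or results of internal computation for use in later rounds.\<close>

datatype action = Action
  (draw: nat) (send: "port \<Rightarrow> msg") (decision: "agent_output option")

instance action :: countable
proof
  have "inj (\<lambda>a. to_nat (draw a, send a, decision a))"
    by (rule injI) (simp add: action.expand)
  then show "\<exists>f :: action \<Rightarrow> nat. inj f" by blast
qed

text \<open>Private information: the id and the preferred group.\<close>

type_synonym priv = "nat \<times> bool"

text \<open>
  The history of an agent lists, latest round first, its own action in the round and the messages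
  that arrived through its ports in that round; its length is the current round. A strategy maps
  the private information and the history to the (randomised) step of the current round. An
  algorithm is a strategy, the same for all agents: agents know neither their position nor the
  size of the ring.
\<close>

type_synonym history = "(action \<times> (port \<Rightarrow> msg)) list"
type_synonym strategy = "priv \<Rightarrow> history \<Rightarrow> action pmf"

section \<open>Executions on a ring\<close>

text \<open>
  The nodes of the ring are \<open>{..<n}\<close>. The agents need not have a common sense of direction:
  \<open>P i\<close> is the port of node \<open>i\<close> that leads to node \<open>i + 1\<close>. In \<open>received\<close>, the edge at port \<open>p\<close>
  of node \<open>i\<close> leads to node \<open>j\<close>, and its other end is the port \<open>P j \<noteq> cw\<close> of \<open>j\<close>.
\<close>

definition neighbour :: "nat \<Rightarrow> nat \<Rightarrow> bool \<Rightarrow> nat" where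
  "neighbour n i cw = (if cw then (i + 1) mod n else (i + n - 1) mod n)"

definition received :: "nat \<Rightarrow> (nat \<Rightarrow> port) \<Rightarrow> (nat \<Rightarrow> action) \<Rightarrow> nat \<Rightarrow> port \<Rightarrow> msg" where
  "received n P acts i p =
     (let cw = (p = P i); j = neighbour n i cw in send (acts j) (P j \<noteq> cw))"

definition ring_round ::
  "nat \<Rightarrow> (nat \<Rightarrow> port) \<Rightarrow> (nat \<Rightarrow> strategy) \<Rightarrow> (nat \<Rightarrow> priv) \<Rightarrow> (nat \<Rightarrow> history) \<Rightarrow>
     (nat \<Rightarrow> history) pmf" where
  "ring_round n P S x h =
     map_pmf (\<lambda>acts i. if i < n then (acts i, received n P acts i) # h i else [])
       (Pi_pmf {..<n} undefined (\<lambda>i. S i (x i) (h i)))"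

primrec run ::
  "nat \<Rightarrow> (nat \<Rightarrow> port) \<Rightarrow> (nat \<Rightarrow> strategy) \<Rightarrow> (nat \<Rightarrow> priv) \<Rightarrow> nat \<Rightarrow> (nat \<Rightarrow> history) \<Rightarrow>
     (nat \<Rightarrow> history) pmf" where
  "run n P S x 0 h = return_pmf h"
| "run n P S x (Suc T) h = bind_pmf (run n P S x T h) (ring_round n P S x)"

text \<open>Outputs are irrevocable: only the first decision counts.\<close>

primrec committed :: "history \<Rightarrow> agent_output option" where
  "committed [] = None"
| "committed (e # h) = (case committed h of Some d \<Rightarrow> Some d | None \<Rightarrow> decision (fst e))"

text \<open>An agent that has not decided counts as aborting, so that an execution in which some agent
  never decides is erroneous.\<close>

definition final_output :: "history \<Rightarrow> agent_output" where
  "final_output h = (case committed h of Some d \<Rightarrow> d | None \<Rightarrow> None)"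

section \<open>Ring Partition\<close>

definition legal :: "nat \<Rightarrow> (nat \<Rightarrow> agent_output) \<Rightarrow> bool" where
  "legal n out \<longleftrightarrow> (\<forall>g. 2 * card {i. i < n \<and> out i = Some g} = n)"

definition utility :: "nat \<Rightarrow> nat \<Rightarrow> bool \<Rightarrow> (nat \<Rightarrow> agent_output) \<Rightarrow> real" where
  "utility n i pref out = (if out i = Some pref \<and> legal n out then 1 else 0)"

text \<open>Private information vectors for a ring of size \<open>n\<close>: distinct ids from the finite pool \<open>I\<close>,
  and any preferences.\<close>

definition private_infos :: "nat \<Rightarrow> nat set \<Rightarrow> (nat \<Rightarrow> priv) set" where
  "private_infos n I = {x \<in> {..<n} \<rightarrow>\<^sub>E I \<times> UNIV. inj_on (fst \<circ> x) {..<n}}"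

text \<open>The pools of ids and the port labellings may depend on the size of the ring: unbounded
  rings cannot draw distinct ids from one finite pool.\<close>

definition solves_ring_partition ::
  "nat pmf \<Rightarrow> (nat \<Rightarrow> nat set) \<Rightarrow> (nat \<Rightarrow> nat \<Rightarrow> port) \<Rightarrow> strategy \<Rightarrow> bool" where
  "solves_ring_partition \<sigma> I P \<Lambda> \<longleftrightarrow>
     (\<forall>n\<in>set_pmf \<sigma>. \<forall>x\<in>private_infos n (I n). \<exists>T.
        \<forall>h\<in>set_pmf (run n (P n) (\<lambda>_. \<Lambda>) x T (\<lambda>_. [])). legal n (\<lambda>i. final_output (h i)))"

section \<open>Beliefs and equilibrium\<close>

text \<open>The joint prior of ring size, private information and the histories of the first \<open>r\<close>
  rounds, if all agents follow \<open>\<Lambda>\<close>.\<close>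

definition executions ::
  "nat pmf \<Rightarrow> (nat \<Rightarrow> nat set) \<Rightarrow> (nat \<Rightarrow> nat \<Rightarrow> port) \<Rightarrow> strategy \<Rightarrow> nat \<Rightarrow>
     (nat \<times> (nat \<Rightarrow> priv) \<times> (nat \<Rightarrow> history)) pmf" where
  "executions \<sigma> I P \<Lambda> r = do {
     n \<leftarrow> \<sigma>;
     x \<leftarrow> pmf_of_set (private_infos n (I n));
     h \<leftarrow> run n (P n) (\<lambda>_. \<Lambda>) x r (\<lambda>_. []);
     return_pmf (n, x, h)
   }"

text \<open>An agent \<open>a\<close> is given by its position \<open>a n\<close> in the ring of each size \<open>n\<close>. All it knows is its
  private information and its history; its belief is the posterior given these.\<close>

definition local_view ::
  "(nat \<Rightarrow> nat) \<Rightarrow> nat \<times> (nat \<Rightarrow> priv) \<times> (nat \<Rightarrow> history) \<Rightarrow> priv \<times> history" where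
  "local_view a = (\<lambda>(n, x, h). (x (a n), h (a n)))"

definition belief ::
  "nat pmf \<Rightarrow> (nat \<Rightarrow> nat set) \<Rightarrow> (nat \<Rightarrow> nat \<Rightarrow> port) \<Rightarrow> strategy \<Rightarrow> (nat \<Rightarrow> nat) \<Rightarrow> nat \<Rightarrow>
     priv \<times> history \<Rightarrow> (nat \<times> (nat \<Rightarrow> priv) \<times> (nat \<Rightarrow> history)) pmf" where
  "belief \<sigma> I P \<Lambda> a r w = cond_pmf (executions \<sigma> I P \<Lambda> r) {e. local_view a e = w}"

text \<open>
  Distribution of the utility of \<open>a\<close>, as estimated by \<open>a\<close> at round \<open>r\<close> with view \<open>w\<close>, for the
  outputs made up to round \<open>r + T\<close>, if \<open>a\<close> plays \<open>\<delta>\<close> from round \<open>r\<close> on and all others follow \<open>\<Lambda>\<close>.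
\<close>

definition utility_after ::
  "nat pmf \<Rightarrow> (nat \<Rightarrow> nat set) \<Rightarrow> (nat \<Rightarrow> nat \<Rightarrow> port) \<Rightarrow> strategy \<Rightarrow> (nat \<Rightarrow> nat) \<Rightarrow> nat \<Rightarrow>
     priv \<times> history \<Rightarrow> strategy \<Rightarrow> nat \<Rightarrow> real pmf" where
  "utility_after \<sigma> I P \<Lambda> a r w \<delta> T = do {
     (n, x, h) \<leftarrow> belief \<sigma> I P \<Lambda> a r w;
     h' \<leftarrow> run n (P n) ((\<lambda>_. \<Lambda>)(a n := \<delta>)) x T h;
     return_pmf (utility n (a n) (snd (x (a n))) (\<lambda>i. final_output (h' i)))
   }"

text \<open>
  A legal vector has no undecided entries and decisions are irrevocable, so along each execution the
  utility is nondecreasing in \<open>T\<close>. Hence the supremum below is the limit, and equals the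
  expected utility of the output vector of the infinite execution.
\<close>

definition expected_utility ::
  "nat pmf \<Rightarrow> (nat \<Rightarrow> nat set) \<Rightarrow> (nat \<Rightarrow> nat \<Rightarrow> port) \<Rightarrow> strategy \<Rightarrow> (nat \<Rightarrow> nat) \<Rightarrow> nat \<Rightarrow>
     priv \<times> history \<Rightarrow> strategy \<Rightarrow> real" where
  "expected_utility \<sigma> I P \<Lambda> a r w \<delta> =
     (SUP T. measure_pmf.expectation (utility_after \<sigma> I P \<Lambda> a r w \<delta> T) (\<lambda>u. u))"

text \<open>
  At every round of every possible execution of \<open>\<Lambda>\<close>, no agent gains by deviating. The step taken by
  \<open>\<delta>\<close> in round \<open>r\<close> is the deviating step, and the deviator may continue in any way; a single
  deviating step after which it returns to \<open>\<Lambda>\<close> is a special case. So is the duplication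
  attack: a cheater simulating imaginary agents affects the others only through the messages on its
  two edges, which \<open>\<delta>\<close> chooses freely (see \<open>sybil\<close> below).
\<close>

definition is_equilibrium ::
  "nat pmf \<Rightarrow> (nat \<Rightarrow> nat set) \<Rightarrow> (nat \<Rightarrow> nat \<Rightarrow> port) \<Rightarrow> strategy \<Rightarrow> bool" where
  "is_equilibrium \<sigma> I P \<Lambda> \<longleftrightarrow>
     (\<forall>a. (\<forall>n\<in>set_pmf \<sigma>. a n < n) \<longrightarrow>
       (\<forall>r. \<forall>w \<in> local_view a ` set_pmf (executions \<sigma> I P \<Lambda> r). \<forall>\<delta>.
          expected_utility \<sigma> I P \<Lambda> a r w \<delta> \<le> expected_utility \<sigma> I P \<Lambda> a r w \<Lambda>))"

definition ring_partition_equilibrium ::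
  "nat pmf \<Rightarrow> (nat \<Rightarrow> nat set) \<Rightarrow> (nat \<Rightarrow> nat \<Rightarrow> port) \<Rightarrow> strategy \<Rightarrow> bool" where
  "ring_partition_equilibrium \<sigma> I P \<Lambda> \<longleftrightarrow>
     solves_ring_partition \<sigma> I P \<Lambda> \<and> is_equilibrium \<sigma> I P \<Lambda>"

section \<open>Duplication is a deviation\<close>

text \<open>
  The agent at node \<open>n - 1\<close> of a ring of size \<open>n\<close> pretends to be the \<open>d = N - (n - 1)\<close> agents at
  nodes \<open>{n - 1..<N}\<close> of a ring of size \<open>N = n + d - 1\<close>, with private information \<open>x j\<close> and port
  labels \<open>P j\<close>. The actions of the imaginary agents are stored in \<open>draw\<close>; \<open>c\<close> is the cheater's own
  clockwise port, and \<open>out\<close> is any rule for its output.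
\<close>

definition imaginary_actions :: "nat \<Rightarrow> nat \<Rightarrow> nat \<Rightarrow> nat \<Rightarrow> action" where
  "imaginary_actions n N k j =
     (if j \<in> {n - 1..<N} then (from_nat k :: action list) ! (j - (n - 1)) else undefined)"

primrec imaginary :: "nat \<Rightarrow> nat \<Rightarrow> (nat \<Rightarrow> port) \<Rightarrow> port \<Rightarrow> history \<Rightarrow> nat \<Rightarrow> history" where
  "imaginary n N P c [] = (\<lambda>_. [])"
| "imaginary n N P c (e # h) =
     (let acts = imaginary_actions n N (draw (fst e)) in
      (\<lambda>j. (acts j, \<lambda>p.
             if j = N - 1 \<and> p = P j then snd e c
             else if j = n - 1 \<and> p \<noteq> P j then snd e (\<not> c)
             else received N P acts j p) # imaginary n N P c h j))"

definition sybil ::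
  "nat \<Rightarrow> nat \<Rightarrow> (nat \<Rightarrow> port) \<Rightarrow> port \<Rightarrow> (nat \<Rightarrow> priv) \<Rightarrow> (history \<Rightarrow> agent_output option) \<Rightarrow>
     strategy \<Rightarrow> strategy" where
  "sybil n N P c x out \<Lambda> = (\<lambda>_ h.
     map_pmf (\<lambda>acts. Action (to_nat (map acts [n - 1..<N]))
                (\<lambda>p. if p = c then send (acts (N - 1)) (P (N - 1))
                     else send (acts (n - 1)) (\<not> P (n - 1)))
                (out h))
       (Pi_pmf {n - 1..<N} undefined (\<lambda>j. \<Lambda> (x j) (imaginary n N P c h j))))"

definition enlarged ::
  "nat \<Rightarrow> nat \<Rightarrow> (nat \<Rightarrow> port) \<Rightarrow> port \<Rightarrow> (nat \<Rightarrow> history) \<Rightarrow> nat \<Rightarrow> history" where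
  "enlarged n N P c h j =
     (if j < n - 1 then h j else if j < N then imaginary n N P c (h (n - 1)) j else [])"

lemma neighbour_clockwise: "i < n \<Longrightarrow> neighbour n i True = (if i = n - 1 then 0 else i + 1)"
  by (cases "i = n - 1") (auto simp: neighbour_def)

lemma neighbour_counterclockwise:
  assumes "i < n" shows "neighbour n i False = (if i = 0 then n - 1 else i - 1)"
proof (cases i)
  case 0
  then show ?thesis using assms by (simp add: neighbour_def)
next
  case (Suc k)
  then have "(i + n - 1) mod n = k" using assms by simp
  then show ?thesis using Suc by (simp add: neighbour_def)
qed

lemma ring_round_sybil:
  assumes n: "2 \<le> n" and N: "n \<le> N" and S: "\<And>i. i < n - 1 \<Longrightarrow> S i = \<Lambda>"
    and cheat: "S (n - 1) = sybil n N Q (P (n - 1)) y out \<Lambda>"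
    and eq: "\<And>i. i < n - 1 \<Longrightarrow> Q i = P i \<and> y i = x i"
  shows "map_pmf (enlarged n N Q (P (n - 1))) (ring_round n P S x h)
       = ring_round N Q (\<lambda>_. \<Lambda>) y (enlarged n N Q (P (n - 1)) h)"
proof -
  define c where "c = P (n - 1)"
  define A where "A = Pi_pmf {..<n - 1} undefined (\<lambda>i. \<Lambda> (x i) (h i))"
  define B where
    "B = Pi_pmf {n - 1..<N} undefined (\<lambda>j. \<Lambda> (y j) (imaginary n N Q c (h (n - 1)) j))"
  define act where "act = (\<lambda>acts. Action (to_nat (map acts [n - 1..<N]))
                (\<lambda>p. if p = c then send (acts (N - 1)) (Q (N - 1))
                     else send (acts (n - 1)) (\<not> Q (n - 1)))
                (out (h (n - 1))))"
  have setn: "{..<n} = insert (n - 1) {..<n - 1}" using n by auto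
  have "Pi_pmf {..<n} undefined (\<lambda>i. S i (x i) (h i))
      = map_pmf (\<lambda>(g, f). f(n - 1 := g))
          (pair_pmf (map_pmf act B) (Pi_pmf {..<n - 1} undefined (\<lambda>i. S i (x i) (h i))))"
    unfolding setn
    by (subst Pi_pmf_insert) (simp_all add: cheat sybil_def act_def B_def c_def del: One_nat_def)
  also have "Pi_pmf {..<n - 1} undefined (\<lambda>i. S i (x i) (h i)) = A"
    unfolding A_def by (rule Pi_pmf_cong) (auto simp: S)
  also have "pair_pmf (map_pmf act B) A = map_pmf (\<lambda>(g, f). (act g, f)) (pair_pmf B A)"
    by (simp add: pair_map_pmf1 apfst_def map_prod_def case_prod_unfold)
  finally have L: "Pi_pmf {..<n} undefined (\<lambda>i. S i (x i) (h i))
      = map_pmf (\<lambda>(g, f). f(n - 1 := act g)) (pair_pmf B A)"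
    by (simp add: pmf.map_comp o_def case_prod_unfold fun_upd_def cong: if_cong)
  have setN: "{..<N} = {..<n - 1} \<union> {n - 1..<N}" using n N by auto
  let ?T = "\<lambda>j. \<Lambda> (y j) (enlarged n N Q c h j)"
  have "Pi_pmf {..<N} undefined ?T
      = map_pmf (\<lambda>(f, g) j. if j \<in> {..<n - 1} then f j else g j)
          (pair_pmf (Pi_pmf {..<n - 1} undefined ?T) (Pi_pmf {n - 1..<N} undefined ?T))"
    unfolding setN by (rule Pi_pmf_union) auto
  also have "Pi_pmf {..<n - 1} undefined ?T = A"
    unfolding A_def by (rule Pi_pmf_cong) (auto simp: enlarged_def eq)
  also have "Pi_pmf {n - 1..<N} undefined ?T = B"
    unfolding B_def by (rule Pi_pmf_cong) (auto simp: enlarged_def)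
  also have "pair_pmf A B = map_pmf (\<lambda>(g, f). (f, g)) (pair_pmf B A)"
    by (subst pair_commute_pmf) (simp add: case_prod_unfold)
  finally have R: "Pi_pmf {..<N} undefined ?T
      = map_pmf (\<lambda>(g, f) j. if j < n - 1 then f j else g j) (pair_pmf B A)"
    by (simp add: pmf.map_comp o_def case_prod_unfold cong: if_cong)
  define F where "F = (\<lambda>g f :: nat \<Rightarrow> action. f(n - 1 := act g))"
  define G where "G = (\<lambda>(g :: nat \<Rightarrow> action) f j. if j < n - 1 then f j else g j)"
  have key: "enlarged n N Q c (\<lambda>i. if i < n then (F g f i, received n P (F g f) i) # h i else [])
      = (\<lambda>i. if i < N then (G g f i, received N Q (G g f) i) # enlarged n N Q c h i else [])"
    if g: "g \<in> set_pmf B" for f g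
  proof
    fix j
    have g0: "g i = undefined" if "i \<notin> {n - 1..<N}" for i
      using g that set_Pi_pmf_subset[OF finite_atLeastLessThan] unfolding B_def
      by (metis (mono_tags, lifting) mem_Collect_eq subsetD)
    have F: "F g f i = (if i = n - 1 then act g else f i)" for i by (simp add: F_def)
    have G: "G g f i = (if i < n - 1 then f i else g i)" for i by (simp add: G_def)
    have dec: "imaginary_actions n N (draw (act g)) = g"
      by (rule ext) (auto simp: imaginary_actions_def act_def g0)
    consider "j < n - 1" | "n - 1 \<le> j" "j < N" | "N \<le> j" by linarith
    then show "enlarged n N Q c (\<lambda>i. if i < n then ((F g f) i, received n P (F g f) i) # h i else []) j
      = (if j < N then ((G g f) j, received N Q (G g f) j) # enlarged n N Q c h j else [])"
    proof cases
      case 1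
      have "received n P (F g f) j p = received N Q (G g f) j p" for p
      proof (cases "p = P j")
        case True
        have "Suc j < n - 1 \<or> n - 1 = Suc j" using 1 by linarith
        then show ?thesis using True 1 n N
          by (auto simp: received_def neighbour_clockwise F G act_def c_def eq)
      next
        case False
        then show ?thesis using 1 n N
          by (auto simp: received_def neighbour_counterclockwise Let_def F G act_def c_def eq)
      qed
      then show ?thesis using 1 n N by (auto simp: enlarged_def F G)
    next
      case 2
      have "(if j = N - 1 \<and> p = Q j then received n P (F g f) (n - 1) c
             else if j = n - 1 \<and> p \<noteq> Q j then received n P (F g f) (n - 1) (\<not> c)
             else received N Q g j p) = received N Q (G g f) j p" for p
      proof (cases "p = Q j")
        case True
        then show ?thesis using 2 n N
          by (auto simp: received_def neighbour_clockwise F G c_def Let_def eq)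
      next
        case False
        then show ?thesis using 2 n N
          by (auto simp: received_def neighbour_counterclockwise F G c_def Let_def eq)
      qed
      then show ?thesis using 2 n N by (auto simp: enlarged_def dec Let_def F G fun_eq_iff cong: if_cong)
    next
      case 3
      then show ?thesis using n N by (auto simp: enlarged_def)
    qed
  qed
  show ?thesis
    unfolding ring_round_def c_def[symmetric] L R pmf.map_comp
  proof (rule map_pmf_cong[OF refl])
    fix gf
    assume "gf \<in> set_pmf (pair_pmf B A)"
    then obtain g f where gf: "gf = (g, f)" and g: "g \<in> set_pmf B" by (cases gf) auto
    show "(enlarged n N Q c \<circ> ((\<lambda>acts i. if i < n then (acts i, received n P acts i) # h i else [])
          \<circ> (\<lambda>(g, f). f(n - 1 := act g)))) gf
      = ((\<lambda>acts i. if i < N then (acts i, received N Q acts i) # enlarged n N Q c h i else [])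
          \<circ> (\<lambda>(g, f) j. if j < n - 1 then f j else g j)) gf"
      using key[OF g, of f] unfolding comp_def gf prod.case F_def G_def .
  qed
qed

text \<open>Under the attack, the histories of the other agents (which \<open>enlarged\<close> keeps, adding those of
  the imaginary agents) are distributed exactly as in an honest execution on the enlarged ring.\<close>

lemma run_sybil:
  assumes "2 \<le> n" and "1 \<le> d" and "N = n + d - 1"
    and "\<And>i. i < n - 1 \<Longrightarrow> Q i = P i \<and> y i = x i"
  shows "map_pmf (enlarged n N Q (P (n - 1)))
           (run n P ((\<lambda>_. \<Lambda>)(n - 1 := sybil n N Q (P (n - 1)) y out \<Lambda>)) x T (\<lambda>_. []))
       = run N Q (\<lambda>_. \<Lambda>) y T (\<lambda>_. [])"
proof (induction T)
  case 0
  show ?case by (simp add: enlarged_def fun_eq_iff)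
next
  case (Suc T)
  have step: "map_pmf (enlarged n N Q (P (n - 1)))
          (ring_round n P ((\<lambda>_. \<Lambda>)(n - 1 := sybil n N Q (P (n - 1)) y out \<Lambda>)) x h)
      = ring_round N Q (\<lambda>_. \<Lambda>) y (enlarged n N Q (P (n - 1)) h)" for h
    by (rule ring_round_sybil) (use assms in auto)
  then show ?case
    by (simp only: run.simps map_bind_pmf Suc[symmetric] bind_map_pmf step)
qed

end

(* The smallest id is elected by circulating ids, and its owner then sends a token around the
   ring, which pairs up adjacent agents. The two agents of a pair exchange random bits in the same
   round, and the exclusive or decides which of them joins which group. Each agent takes part in
   only one exchange, so pairs of honest agents are balanced whatever a deviator does, and the
   outcome is illegal unless exactly one honest agent exchanges bits with the deviator and gets the
   group that the deviator does not want. That agent's bit is fresh, so this has probability at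
   most 1/2, until the exchange fixes the outcome. Conversely, honest play ends legally with
   certainty, so the same bound for the other group shows that it attains this value. Nothing
   here depends on the beliefs about the size of the ring. *)

theory Submission
  imports Defs
begin

section \<open>The protocol\<close>

text \<open>The components of a message are: an id taking part in the election; a token, which tells its
  receiver whether to answer its sender (\<^term>\<open>True\<close>) or to initiate the next pair; and a coin,
  given by whether its sender is the initiator and the random bit.\<close>

type_synonym content = "nat option \<times> bool option \<times> (bool \<times> bool) option"

definition encode :: "content \<Rightarrow> msg" where
  "encode c = [to_nat c]"

definition decode :: "msg \<Rightarrow> content" where
  "decode m = (case m of [k] \<Rightarrow> from_nat k | _ \<Rightarrow> (None, None, None))"

lemma decode_encode [simp]: "decode (encode c) = c"
  by (simp add: decode_def encode_def)

definition candidate :: "msg \<Rightarrow> nat option" where "candidate m = fst (decode m)"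
definition token :: "msg \<Rightarrow> bool option" where "token m = fst (snd (decode m))"
definition coin :: "msg \<Rightarrow> (bool \<times> bool) option" where "coin m = snd (snd (decode m))"

lemma message_parts [simp]:
  "candidate (encode (c, t, b)) = c" "token (encode (c, t, b)) = t" "coin (encode (c, t, b)) = b"
  by (simp_all add: candidate_def token_def coin_def)

definition coin_port :: "action \<Rightarrow> port option" where
  "coin_port a = (if coin (send a False) \<noteq> None then Some False
                  else if coin (send a True) \<noteq> None then Some True else None)"

text \<open>The own coin comes first. The initiator gets the exclusive or of the bits and the
  responder its negation, so the two sides get complementary groups; equal roles or a missing coin
  spoil the exchange.\<close>

definition exchange :: "(bool \<times> bool) option \<Rightarrow> (bool \<times> bool) option \<Rightarrow> bool option" where
  "exchange c c' = (case (c, c') of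
     (Some (r, b), Some (r', b')) \<Rightarrow> if r \<noteq> r' then Some ((b \<noteq> b') = r) else None
   | _ \<Rightarrow> None)"

lemma exchange_opposite: "exchange c c' = Some g \<Longrightarrow> exchange c' c = Some (\<not> g)"
  by (auto simp: exchange_def split: option.splits if_splits)

lemma exchange_eq_SomeD:
  "exchange c c' = Some g \<Longrightarrow> (\<exists>z. c = Some z) \<and> (\<exists>z. c' = Some z)"
  by (auto simp: exchange_def split: option.splits)

text \<open>The port of the first exchange of bits and its result, if the other side took part properly.\<close>

primrec engaged :: "history \<Rightarrow> (port \<times> bool option) option" where
  "engaged [] = None"
| "engaged (e # h) = (case engaged h of Some z \<Rightarrow> Some z | None \<Rightarrow>
     map_option (\<lambda>q. (q, exchange (coin (send (fst e) q)) (coin (snd e q)))) (coin_port (fst e)))"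

definition result :: "history \<Rightarrow> bool option" where
  "result h = Option.bind (engaged h) snd"

lemma result_eq_Some_iff: "result h = Some g \<longleftrightarrow> (\<exists>q. engaged h = Some (q, Some g))"
  by (auto simp: result_def Option.bind_eq_Some_conv)

text \<open>The return of its own id counts, for the elected leader, as the arrival of a token. Ids are
  sent in both directions, so testing only one port ensures that a single token is created.\<close>

primrec arrival :: "nat \<Rightarrow> history \<Rightarrow> port \<Rightarrow> bool option" where
  "arrival i [] p = None"
| "arrival i (e # h) p =
     (if \<not> p \<and> candidate (snd e p) = Some i then Some False else token (snd e p))"

text \<open>As in the election of Chang and Roberts, an id gets only past owners of larger ids, so
  only the smallest one completes a tour.\<close>

definition relay_candidate :: "nat \<Rightarrow> history \<Rightarrow> port \<Rightarrow> nat option" where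
  "relay_candidate i h q = (case h of [] \<Rightarrow> Some i | e # _ \<Rightarrow>
     (case candidate (snd e (\<not> q)) of Some j \<Rightarrow> if j < i then Some j else None | None \<Rightarrow> None))"

text \<open>Negating at each hop makes initiators and responders alternate along the tour.\<close>

definition relay_token :: "nat \<Rightarrow> history \<Rightarrow> port \<Rightarrow> bool option" where
  "relay_token i h q = map_option Not (arrival i h (\<not> q))"

text \<open>An initiator waits one round after passing on the token, so that its bit and the answer
  cross.\<close>

definition engagement :: "nat \<Rightarrow> history \<Rightarrow> (port \<times> bool) option" where
  "engagement i h =
     (if engaged h \<noteq> None then None
      else if \<exists>p. arrival i h p = Some True then Some (arrival i h True = Some True, False)
      else if \<exists>p. arrival i (tl h) p = Some False
        then Some (arrival i (tl h) True \<noteq> Some False, True)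
      else None)"

definition coin_at :: "nat \<Rightarrow> history \<Rightarrow> bool \<Rightarrow> port \<Rightarrow> (bool \<times> bool) option" where
  "coin_at i h b q = (case engagement i h of
     Some (q', r) \<Rightarrow> if q = q' then Some (r, b) else None | None \<Rightarrow> None)"

text \<open>The random bit is an argument, so that probability enters in \<open>protocol\<close>
  alone. An agent whose exchange was spoiled never decides, which makes the outcome illegal.\<close>

definition honest_step :: "nat \<Rightarrow> history \<Rightarrow> bool \<Rightarrow> action" where
  "honest_step i h b = Action 0
     (\<lambda>q. encode (relay_candidate i h q, relay_token i h q, coin_at i h b q))
     (map_option Some (result h))"

text \<open>A fresh bit is drawn in every round, so the one that is sent is independent of the
  history before.\<close>

definition protocol :: strategy where
  "protocol = (\<lambda>x h. map_pmf (honest_step (fst x) h) (pmf_of_set UNIV))"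

lemma set_pmf_protocol: "set_pmf (protocol x h) = range (honest_step (fst x) h)"
  by (simp add: protocol_def)

lemma send_honest_step [simp]:
  "candidate (send (honest_step i h b) q) = relay_candidate i h q"
  "token (send (honest_step i h b) q) = relay_token i h q"
  "coin (send (honest_step i h b) q) = coin_at i h b q"
  "decision (honest_step i h b) = map_option Some (result h)"
  by (simp_all add: honest_step_def)

lemma coin_port_honest_step: "coin_port (honest_step i h b) = map_option fst (engagement i h)"
proof (cases "engagement i h")
  case (Some z)
  then show ?thesis by (cases z; cases "fst z") (auto simp: coin_port_def coin_at_def)
qed (auto simp: coin_port_def coin_at_def)

lemma coin_at_eq_Some_iff:
  "coin_at i h b q = Some z \<longleftrightarrow> (\<exists>r. engagement i h = Some (q, r) \<and> z = (r, b))"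
  by (auto simp: coin_at_def split: option.splits if_splits)

lemma engagement_SomeD: "engagement i h = Some z \<Longrightarrow> engaged h = None"
  by (cases "engaged h") (auto simp: engagement_def)

lemma engaged_honest_step:
  "engaged ((honest_step i h b, m) # h) = (case engaged h of Some z \<Rightarrow> Some z | None \<Rightarrow>
     map_option (\<lambda>(q, r). (q, exchange (Some (r, b)) (coin (m q)))) (engagement i h))"
  by (cases "engagement i h"; cases "engaged h") (auto simp: coin_port_honest_step coin_at_def)

lemma engaged_mono: "engaged h = Some z \<Longrightarrow> engaged (e # h) = Some z"
  by simp

lemma result_mono: "result h = Some g \<Longrightarrow> result (e # h) = Some g"
  by (auto simp: result_eq_Some_iff engaged_mono)

declare engaged.simps(2) [simp del]

section \<open>Edges of the ring\<close>

definition across :: "nat \<Rightarrow> (nat \<Rightarrow> port) \<Rightarrow> nat \<Rightarrow> port \<Rightarrow> nat" where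
  "across n P i q = neighbour n i (q = P i)"

text \<open>The label that the node across gives to the same edge. It is computed from the direction
  and not from the pair of nodes, so the two edges of a ring of size two are kept apart.\<close>

definition peer_port :: "nat \<Rightarrow> (nat \<Rightarrow> port) \<Rightarrow> nat \<Rightarrow> port \<Rightarrow> port" where
  "peer_port n P i q = (P (across n P i q) \<noteq> (q = P i))"

lemma received_eq: "received n P acts i q = send (acts (across n P i q)) (peer_port n P i q)"
  by (simp add: received_def across_def peer_port_def Let_def)

lemma neighbour_less: "i < n \<Longrightarrow> neighbour n i d < n"
  by (simp add: neighbour_def)

lemma neighbour_neighbour:
  assumes "i < n" shows "neighbour n (neighbour n i d) (\<not> d) = i"
  using assms neighbour_less[OF assms, of d]
  by (cases d) (auto simp: neighbour_clockwise neighbour_counterclockwise)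

lemma across_less: "i < n \<Longrightarrow> across n P i q < n"
  by (simp add: across_def neighbour_less)

lemma across_peer_port: "i < n \<Longrightarrow> across n P (across n P i q) (peer_port n P i q) = i"
proof -
  assume "i < n"
  have "(peer_port n P i q = P (across n P i q)) = (\<not> (q = P i))"
    by (auto simp: peer_port_def)
  then show ?thesis
    using neighbour_neighbour[OF \<open>i < n\<close>, of "q = P i"] by (simp add: across_def)
qed

lemma peer_port_peer_port: "i < n \<Longrightarrow> peer_port n P (across n P i q) (peer_port n P i q) = q"
  using across_peer_port[of i n P q] by (auto simp: peer_port_def)

lemma set_ring_round:
  assumes "h' \<in> set_pmf (ring_round n P S x h)"
  obtains acts where "\<forall>i<n. acts i \<in> set_pmf (S i (x i) (h i))"
    and "h' = (\<lambda>i. if i < n then (acts i, received n P acts i) # h i else [])"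
  using assms by (auto simp: ring_round_def set_Pi_pmf PiE_dflt_def)

section \<open>Only one agent deviates\<close>

text \<open>In this section, agent \<open>a\<close> is the only one that may deviate. If \<open>n \<le> a\<close>, no agent of the
  ring does.\<close>

definition consistent :: "nat \<Rightarrow> (nat \<Rightarrow> port) \<Rightarrow> nat \<Rightarrow> (nat \<Rightarrow> history) \<Rightarrow> bool" where
  "consistent n P a h \<longleftrightarrow> (\<forall>i<n. i \<noteq> a \<longrightarrow>
     (\<forall>d. committed (h i) = Some d \<longrightarrow> d \<noteq> None \<and> result (h i) = d) \<and>
     (\<forall>q g. engaged (h i) = Some (q, Some g) \<longrightarrow> across n P i q \<noteq> a \<longrightarrow>
        engaged (h (across n P i q)) = Some (peer_port n P i q, Some (\<not> g))))"

text \<open>An honest agent sends a coin only in the round of its own exchange. Hence a coin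
  received from it shows that both sides exchange in this round over this edge, and
  \<open>exchange_opposite\<close> makes the results complementary.\<close>

lemma consistent_step:
  assumes h: "consistent n P a h"
    and h': "h' \<in> set_pmf (ring_round n P ((\<lambda>_. protocol)(a := \<delta>)) x h)"
  shows "consistent n P a h'"
proof -
  from h' obtain acts where
    acts: "\<forall>i<n. acts i \<in> set_pmf (((\<lambda>_. protocol)(a := \<delta>)) i (x i) (h i))"
    and h'_eq: "h' = (\<lambda>i. if i < n then (acts i, received n P acts i) # h i else [])"
    by (rule set_ring_round)
  have step: "\<exists>b. acts i = honest_step (fst (x i)) (h i) b" if "i < n" "i \<noteq> a" for i
    using acts[rule_format, OF that(1)] that(2) by (simp add: set_pmf_protocol image_def)
  have new: "\<exists>b r. acts i = honest_step (fst (x i)) (h i) b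
      \<and> engagement (fst (x i)) (h i) = Some (q, r)
      \<and> res = exchange (Some (r, b)) (coin (received n P acts i q))"
    if i: "i < n" "i \<noteq> a" and "engaged (h i) = None" "engaged (h' i) = Some (q, res)" for i q res
  proof -
    obtain b where "acts i = honest_step (fst (x i)) (h i) b" using step[OF i] by blast
    then show ?thesis
      using that by - (rule exI[of _ b], auto simp: h'_eq engaged_honest_step)
  qed
  show ?thesis
    unfolding consistent_def
  proof (intro allI impI conjI)
    fix i d assume i: "i < n" "i \<noteq> a" and d: "committed (h' i) = Some d"
    obtain b where b: "acts i = honest_step (fst (x i)) (h i) b" using step[OF i] by blast
    have "d \<noteq> None \<and> result (h i) = d"
      using d h i by (auto simp: consistent_def h'_eq b split: option.splits)
    then show "d \<noteq> None" "result (h' i) = d"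
      by (auto simp: h'_eq i result_mono)
  next
    fix i q g
    assume i: "i < n" "i \<noteq> a" and e: "engaged (h' i) = Some (q, Some g)"
      and j: "across n P i q \<noteq> a"
    define k where "k = across n P i q"
    have k: "k < n" "k \<noteq> a" using i j by (auto simp: k_def across_less)
    have "engaged (h' k) = Some (peer_port n P i q, Some (\<not> g))"
    proof (cases "engaged (h i)")
      case (Some z)
      then have "z = (q, Some g)" using e i by (simp add: h'_eq engaged_mono)
      then show ?thesis using Some h i j k by (auto simp: consistent_def h'_eq k_def engaged_mono)
    next
      case None
      obtain b r where b: "acts i = honest_step (fst (x i)) (h i) b"
        and r: "engagement (fst (x i)) (h i) = Some (q, r)"
        and g: "Some g = exchange (Some (r, b)) (coin (received n P acts i q))"
        using new[OF i None e] by blast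
      obtain b' where b': "acts k = honest_step (fst (x k)) (h k) b'" using step[OF k] by blast
      have c: "coin (received n P acts i q) = coin_at (fst (x k)) (h k) b' (peer_port n P i q)"
        by (simp add: received_eq k_def[symmetric] b')
      obtain r' where r': "engagement (fst (x k)) (h k) = Some (peer_port n P i q, r')"
        using exchange_eq_SomeD[OF g[symmetric]] unfolding c by (auto simp: coin_at_eq_Some_iff)
      have c': "coin (received n P acts k (peer_port n P i q)) = Some (r, b)"
        unfolding k_def
        by (simp add: received_eq across_peer_port peer_port_peer_port i b coin_at_def r)
      have "coin (received n P acts i q) = Some (r', b')"
        unfolding c by (simp add: coin_at_def r')
      then have "exchange (Some (r', b')) (Some (r, b)) = Some (\<not> g)"
        using g exchange_opposite by metis
      then show ?thesis
        using k engagement_SomeD[OF r'] by (simp add: h'_eq b' engaged_honest_step r' c')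
    qed
    then show "engaged (h' (across n P i q)) = Some (peer_port n P i q, Some (\<not> g))"
      by (simp add: k_def)
  qed
qed

lemma consistent_run:
  assumes "consistent n P a h"
    and "h' \<in> set_pmf (run n P ((\<lambda>_. protocol)(a := \<delta>)) x T h)"
  shows "consistent n P a h'"
  using assms(2)
proof (induction T arbitrary: h')
  case (Suc T)
  then show ?case by (auto intro: consistent_step simp del: fun_upd_apply)
qed (simp add: assms(1))

text \<open>Honest agents whose only exchange went over an edge to \<open>a\<close>. Spoiled
  exchanges count as well, since they too use up the agent.\<close>

definition captives :: "nat \<Rightarrow> (nat \<Rightarrow> port) \<Rightarrow> nat \<Rightarrow> (nat \<Rightarrow> history) \<Rightarrow> nat set" where
  "captives n P a h =
     {i. i < n \<and> i \<noteq> a \<and> (\<exists>q res. engaged (h i) = Some (q, res) \<and> across n P i q = a)}"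

lemma card_captives: "card (captives n P a h) \<le> 2"
proof -
  have "captives n P a h \<subseteq> {neighbour n a True, neighbour n a False}"
  proof
    fix i assume "i \<in> captives n P a h"
    then obtain d where "i < n" "neighbour n i d = a" by (auto simp: captives_def across_def)
    then show "i \<in> {neighbour n a True, neighbour n a False}"
      using neighbour_neighbour[of i n d] by (cases d) auto
  qed
  then have "card (captives n P a h) \<le> card {neighbour n a True, neighbour n a False}"
    by (intro card_mono) auto
  also have "\<dots> \<le> 2" by (simp add: card_insert_if)
  finally show ?thesis .
qed

lemma finite_captives [simp]: "finite (captives n P a h)"
  by (simp add: captives_def)

section \<open>Balance of the groups outside the captives\<close>

definition assigned :: "nat \<Rightarrow> nat \<Rightarrow> (nat \<Rightarrow> history) \<Rightarrow> bool \<Rightarrow> nat set" where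
  "assigned n a h g = {i. i < n \<and> i \<noteq> a \<and> result (h i) = Some g}"

lemma finite_assigned [simp]: "finite (assigned n a h g)"
  by (simp add: assigned_def)

text \<open>Following the edge of the exchange is an involution that swaps the two groups; it stays
  away from \<open>a\<close> once the captives are removed.\<close>

lemma card_assigned_le:
  assumes "consistent n P a h"
  shows "card (assigned n a h g - captives n P a h) \<le> card (assigned n a h (\<not> g) - captives n P a h)"
proof -
  define partner where "partner i = across n P i (fst (the (engaged (h i))))" for i
  have *: "partner i \<in> assigned n a h (\<not> g) - captives n P a h \<and> partner (partner i) = i"
    if "i \<in> assigned n a h g - captives n P a h" for i
  proof -
    from that obtain q where i: "i < n" "i \<noteq> a" and q: "engaged (h i) = Some (q, Some g)"
      and ne: "across n P i q \<noteq> a"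
      by (auto simp: assigned_def captives_def result_eq_Some_iff)
    have e: "engaged (h (across n P i q)) = Some (peer_port n P i q, Some (\<not> g))"
      using assms i q ne by (auto simp: consistent_def)
    then show ?thesis
      using i q ne by (auto simp: partner_def assigned_def captives_def result_eq_Some_iff
          across_less across_peer_port)
  qed
  show ?thesis
  proof (rule card_inj_on_le)
    show "inj_on partner (assigned n a h g - captives n P a h)"
      by (rule inj_on_inverseI[of _ partner]) (use * in blast)
  qed (use * in auto)
qed

lemma card_assigned:
  assumes "consistent n P a h"
  shows "card (assigned n a h g - captives n P a h) = card (assigned n a h (\<not> g) - captives n P a h)"
  using card_assigned_le[OF assms, of g] card_assigned_le[OF assms, of "\<not> g"] by simp

text \<open>A supermartingale that bounds the probability that \<open>a\<close> gets group \<open>p\<close> in a legal outcome.\<close>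

definition potential :: "nat \<Rightarrow> (nat \<Rightarrow> port) \<Rightarrow> nat \<Rightarrow> bool \<Rightarrow> (nat \<Rightarrow> history) \<Rightarrow> real" where
  "potential n P a p h =
     (if captives n P a h = {} then 1 / 2
      else if \<forall>i\<in>captives n P a h. result (h i) = Some (\<not> p) then 1 else 0)"

lemma potential_bounds: "0 \<le> potential n P a p h" "potential n P a p h \<le> 1"
  by (auto simp: potential_def)

lemma potential_add_potential: "potential n P a p h + potential n P a (\<not> p) h \<le> 1"
  by (auto simp: potential_def)

text \<open>In a legal outcome with \<open>a\<close> in group \<open>p\<close>, the honest members
  of the other group outnumber those of \<open>p\<close> by one. Outside the captives the groups
  balance, so the surplus lies among the at most two captives: there is exactly one, and it is in
  the group opposite to \<open>p\<close>.\<close>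

lemma utility_le_potential:
  assumes h: "consistent n P a h" and a: "a < n"
  shows "utility n a p (\<lambda>i. final_output (h i)) \<le> potential n P a p h"
proof (cases "final_output (h a) = Some p \<and> legal n (\<lambda>i. final_output (h i))")
  case True
  define Q where "Q g = {i. i < n \<and> final_output (h i) = Some g}" for g
  define A where "A = assigned n a h"
  define C where "C = captives n P a h"
  have Q: "2 * card (Q g) = n" for g using True by (auto simp: legal_def Q_def)
  have fin: "finite (Q g)" for g by (simp add: Q_def)
  have disj: "Q p \<inter> Q (\<not> p) = {}" by (auto simp: Q_def)
  have "card (Q p \<union> Q (\<not> p)) = card {..<n}"
    using Q[of p] Q[of "\<not> p"] disj fin by (simp add: card_Un_disjoint)
  then have total: "Q p \<union> Q (\<not> p) = {..<n}"
    by (intro card_subset_eq) (auto simp: Q_def)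
  have res: "result (h i) = Some g" if "i \<in> Q g" "i \<noteq> a" for i g
    using h that by (fastforce simp: consistent_def Q_def final_output_def split: option.splits)
  have sub: "Q g - {a} \<subseteq> A g" for g
    using res by (auto simp: A_def assigned_def Q_def)
  \<comment> \<open>A result may be known before it is output. Legality makes every agent output a
    group, so here results and outputs agree.\<close>
  have A_eq: "A g = Q g - {a}" for g
  proof
    show "A g \<subseteq> Q g - {a}"
    proof
      fix i assume i: "i \<in> A g"
      then have "i \<in> Q p \<union> Q (\<not> p)" unfolding total by (simp add: A_def assigned_def)
      then obtain g' where g': "i \<in> Q g'" by blast
      have "i \<noteq> a" "result (h i) = Some g" using i by (auto simp: A_def assigned_def)
      then show "i \<in> Q g - {a}" using res[OF g'] g' by auto
    qed
  qed (rule sub)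
  have aQ: "a \<in> Q p" "a \<notin> Q (\<not> p)" using True a by (auto simp: Q_def)
  have "card (A p) + 1 = card (Q p)" using card.remove[OF fin aQ(1)] by (simp add: A_eq)
  moreover have "card (A (\<not> p)) = card (Q (\<not> p))" using aQ by (simp add: A_eq)
  ultimately have 1: "card (A p) + 1 = card (A (\<not> p))" using Q[of p] Q[of "\<not> p"] by simp
  have 2: "card (A g) = card (A g - C) + card (A g \<inter> C)" for g
    using card_Int_Diff[of "A g" C] by (simp add: A_def)
  have 3: "card (A p - C) = card (A (\<not> p) - C)"
    using card_assigned[OF h, of p] by (simp add: A_def C_def)
  have cov: "C \<subseteq> A p \<union> A (\<not> p)"
    using total by (auto simp: A_eq C_def captives_def)
  have disjA: "A p \<inter> A (\<not> p) = {}" using disj by (auto simp: A_eq)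
  have "card ((A p \<inter> C) \<union> (A (\<not> p) \<inter> C)) = card (A p \<inter> C) + card (A (\<not> p) \<inter> C)"
    using disjA by (intro card_Un_disjoint) (auto simp: C_def)
  moreover have "(A p \<inter> C) \<union> (A (\<not> p) \<inter> C) = C" using cov by auto
  ultimately have "card (A p \<inter> C) + card (A (\<not> p) \<inter> C) \<le> 2"
    using card_captives[of n P a h] by (simp add: C_def)
  then have z: "card (A p \<inter> C) = 0" "card (A (\<not> p) \<inter> C) = 1" using 1 2[of p] 2[of "\<not> p"] 3 by linarith+
  then have "A p \<inter> C = {}" by (auto simp: C_def)
  then have "\<forall>i\<in>C. result (h i) = Some (\<not> p)" using cov by (auto simp: A_def assigned_def)
  moreover have "C \<noteq> {}" using z by auto
  ultimately have "potential n P a p h = 1" by (simp add: potential_def C_def)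
  then show ?thesis by (simp add: utility_def)
qed (auto simp: utility_def potential_bounds)

section \<open>The supermartingale bound from a fresh bit\<close>

lemma nn_integral_coin_le:
  "(\<integral>\<^sup>+b. indicator {b. exchange (Some (r, b)) c = Some g} b \<partial>measure_pmf (pmf_of_set UNIV)) \<le> ennreal (1 / 2)"
proof -
  \<comment> \<open>\<open>b0\<close> solves \<open>((b \<noteq> b') = r) = g\<close> for
    \<open>b\<close>, so at most one value of the bit gives \<open>g\<close>. Without an answer no
    bit does, and any default serves.\<close>
  define b0 where "b0 = (case c of Some (_, b') \<Rightarrow> b' \<noteq> (r = g) | None \<Rightarrow> False)"
  have "(\<integral>\<^sup>+b. indicator {b. exchange (Some (r, b)) c = Some g} b \<partial>measure_pmf (pmf_of_set UNIV))
      \<le> (\<integral>\<^sup>+b. indicator {b0} b \<partial>measure_pmf (pmf_of_set UNIV))"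
    by (intro nn_integral_mono)
      (auto simp: indicator_def exchange_def b0_def split: option.splits if_splits)
  also have "\<dots> = ennreal (1 / 2)" by (simp add: emeasure_pmf_single UNIV_bool)
  finally show ?thesis .
qed

text \<open>A potential of 0 is permanent and 1 is the maximum. From 1/2 it moves only when an
  honest agent exchanges with \<open>a\<close>; the bit of that agent is independent of what
  \<open>a\<close> sends in the same round, so the potential becomes 1 with probability at most
  1/2.\<close>

lemma nn_integral_potential_step:
  defines "S \<equiv> \<lambda>a \<delta>. (\<lambda>_. protocol)(a := \<delta>)"
  shows "(\<integral>\<^sup>+h'. potential n P a p h' \<partial>measure_pmf (ring_round n P (S a \<delta>) x h)) \<le> potential n P a p h"
proof -
  define after where "after acts = (\<lambda>i. if i < n then (acts i, received n P acts i) # h i else [])"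
    for acts :: "nat \<Rightarrow> action"
  have le_const: "(\<integral>\<^sup>+h'. potential n P a p h' \<partial>measure_pmf (ring_round n P (S a \<delta>) x h)) \<le> ennreal c"
    if "\<And>h'. h' \<in> set_pmf (ring_round n P (S a \<delta>) x h) \<Longrightarrow> potential n P a p h' \<le> c" for c
  proof -
    have "(\<integral>\<^sup>+h'. potential n P a p h' \<partial>measure_pmf (ring_round n P (S a \<delta>) x h))
        \<le> (\<integral>\<^sup>+h'. ennreal c \<partial>measure_pmf (ring_round n P (S a \<delta>) x h))"
      by (intro nn_integral_mono_AE) (auto simp: AE_measure_pmf_iff intro!: ennreal_leI that)
    then show ?thesis by simp
  qed
  have old: "engaged (after acts i) = engaged (h i)" if "engaged (h i) \<noteq> None" "i < n" for acts i
    using that by (auto simp: after_def engaged_mono)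
  show ?thesis
  proof (cases "captives n P a h = {}")
    case False
    show ?thesis
    proof (cases "potential n P a p h = 1")
      case True
      show ?thesis unfolding True by (intro le_const potential_bounds)
    next
      case False
      then obtain i where i: "i \<in> captives n P a h" "result (h i) \<noteq> Some (\<not> p)"
        and z: "potential n P a p h = 0"
        using \<open>captives n P a h \<noteq> {}\<close> by (auto simp: potential_def split: if_splits)
      have "potential n P a p h' = 0" if h': "h' \<in> set_pmf (ring_round n P (S a \<delta>) x h)" for h'
      proof -
        obtain acts where "h' = after acts"
          using set_ring_round[OF h'] unfolding after_def by metis
        then have "engaged (h' i) = engaged (h i)" using i(1) old by (auto simp: captives_def)
        then have "i \<in> captives n P a h'" "result (h' i) \<noteq> Some (\<not> p)"
          using i by (auto simp: captives_def result_def)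
        then show ?thesis by (auto simp: potential_def)
      qed
      then show ?thesis unfolding z by (intro le_const) auto
    qed
  next
    case empty: True
    then have half: "potential n P a p h = 1 / 2" by (simp add: potential_def)
    show ?thesis
    \<comment> \<open>Engagement is determined by \<open>h\<close>, so it is known before the bits
      are drawn whether some \<open>v\<close> is about to exchange with \<open>a\<close>.\<close>
    proof (cases "\<exists>v q r. v < n \<and> v \<noteq> a \<and> engagement (fst (x v)) (h v) = Some (q, r) \<and> across n P v q = a")
      case False
      have "captives n P a h' = {}" if h': "h' \<in> set_pmf (ring_round n P (S a \<delta>) x h)" for h'
      proof (rule ccontr)
        assume "captives n P a h' \<noteq> {}"
        then obtain i q res where i: "i < n" "i \<noteq> a" "engaged (h' i) = Some (q, res)" "across n P i q = a"
          by (auto simp: captives_def)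
        obtain acts where acts: "\<forall>i<n. acts i \<in> set_pmf (S a \<delta> i (x i) (h i))" and h'_eq: "h' = after acts"
          using set_ring_round[OF h'] unfolding after_def by metis
        obtain b where b: "acts i = honest_step (fst (x i)) (h i) b"
          using acts[rule_format, OF i(1)] i(2) by (auto simp: set_pmf_protocol S_def)
        have "engaged (h i) = None" 
        proof (rule ccontr)
          assume "engaged (h i) \<noteq> None"
          then have "i \<in> captives n P a h" using i old[of i acts] by (auto simp: captives_def h'_eq)
          then show False using empty by simp
        qed
        then show False using i False by (auto simp: h'_eq after_def b engaged_honest_step)
      qed
      then show ?thesis unfolding half by (intro le_const) (auto simp: potential_def)
    next
      case True
      then obtain v q r where v: "v < n" "v \<noteq> a" and e: "engagement (fst (x v)) (h v) = Some (q, r)"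
        and a: "across n P v q = a" by blast
      \<comment> \<open>All actions except that of \<open>v\<close> are grouped, including the step
        of \<open>a\<close>, so that the bit of \<open>v\<close> is integrated with the answer
        \<open>c f\<close> fixed.\<close>
      define R where "R = Pi_pmf ({..<n} - {v}) undefined (\<lambda>i. S a \<delta> i (x i) (h i))"
      define c where "c f = coin (send (f a) (peer_port n P v q))" for f :: "nat \<Rightarrow> action"
      let ?coin = "pmf_of_set (UNIV :: bool set)"
      have "Pi_pmf {..<n} undefined (\<lambda>i. S a \<delta> i (x i) (h i))
          = map_pmf (\<lambda>(y, f). f(v := y)) (pair_pmf (protocol (x v) (h v)) R)"
        using Pi_pmf_insert[of "{..<n} - {v}" v undefined "\<lambda>i. S a \<delta> i (x i) (h i)"] v
        by (simp add: R_def insert_absorb S_def)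
      also have "\<dots> = map_pmf (\<lambda>(f, b). f(v := honest_step (fst (x v)) (h v) b)) (pair_pmf R ?coin)"
        by (subst pair_commute_pmf)
          (simp add: protocol_def pair_map_pmf2 pmf.map_comp o_def case_prod_unfold apsnd_def)
      finally have round: "ring_round n P (S a \<delta>) x h =
          map_pmf (\<lambda>(f, b). after (f(v := honest_step (fst (x v)) (h v) b))) (pair_pmf R ?coin)"
        by (simp add: ring_round_def after_def pmf.map_comp o_def case_prod_unfold)
      \<comment> \<open>A second captive may appear in the same round, but potential 1 requires
        every captive to hold \<open>\<not> p\<close>, so the condition on \<open>v\<close> alone is
        a bound.\<close>
      have le: "potential n P a p (after (f(v := honest_step (fst (x v)) (h v) b)))
          \<le> indicator {b. exchange (Some (r, b)) (c f) = Some (\<not> p)} b" for f b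
      proof -
        let ?h = "after (f(v := honest_step (fst (x v)) (h v) b))"
        have "engaged (?h v) = Some (q, exchange (Some (r, b)) (c f))"
          using v e engagement_SomeD[OF e]
          by (simp add: after_def engaged_honest_step received_eq a c_def)
        then have "v \<in> captives n P a ?h" "result (?h v) = exchange (Some (r, b)) (c f)"
          using v a by (auto simp: captives_def result_def)
        then show ?thesis by (auto simp: potential_def indicator_def intro: rev_bexI[of v])
      qed
      have "(\<integral>\<^sup>+h'. potential n P a p h' \<partial>measure_pmf (ring_round n P (S a \<delta>) x h))
          = (\<integral>\<^sup>+f. \<integral>\<^sup>+b. potential n P a p (after (f(v := honest_step (fst (x v)) (h v) b)))
              \<partial>measure_pmf ?coin \<partial>measure_pmf R)"
        by (simp add: round nn_integral_pair_pmf' case_prod_unfold)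
      also have "\<dots> \<le> (\<integral>\<^sup>+f. \<integral>\<^sup>+b. indicator {b. exchange (Some (r, b)) (c f) = Some (\<not> p)} b
              \<partial>measure_pmf ?coin \<partial>measure_pmf R)"
        by (intro nn_integral_mono order_trans[OF ennreal_leI[OF le]]) (simp add: ennreal_indicator)
      also have "\<dots> \<le> (\<integral>\<^sup>+f. ennreal (1 / 2) \<partial>measure_pmf R)"
        by (intro nn_integral_mono nn_integral_coin_le)
      finally show ?thesis by (simp add: half)
    qed
  qed
qed

lemma nn_integral_potential_run:
  "(\<integral>\<^sup>+h'. potential n P a p h' \<partial>measure_pmf (run n P ((\<lambda>_. protocol)(a := \<delta>)) x T h))
     \<le> potential n P a p h"
proof (induction T)
  case (Suc T)
  have "(\<integral>\<^sup>+h'. potential n P a p h' \<partial>measure_pmf (run n P ((\<lambda>_. protocol)(a := \<delta>)) x (Suc T) h))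
      \<le> (\<integral>\<^sup>+h'. potential n P a p h' \<partial>measure_pmf (run n P ((\<lambda>_. protocol)(a := \<delta>)) x T h))"
    unfolding run.simps nn_integral_bind_pmf by (intro nn_integral_mono nn_integral_potential_step)
  then show ?case using Suc.IH by (rule order_trans)
qed simp

lemma expectation_utility_le:
  assumes "consistent n P a h" and "a < n"
  shows "measure_pmf.expectation (run n P ((\<lambda>_. protocol)(a := \<delta>)) x T h)
           (\<lambda>h'. utility n a p (\<lambda>i. final_output (h' i))) \<le> potential n P a p h"
proof -
  let ?M = "measure_pmf (run n P ((\<lambda>_. protocol)(a := \<delta>)) x T h)"
  let ?u = "\<lambda>h'. utility n a p (\<lambda>i. final_output (h' i))"
  have "ennreal (\<integral>h'. ?u h' \<partial>?M) = (\<integral>\<^sup>+h'. ?u h' \<partial>?M)"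
    by (intro nn_integral_eq_integral[symmetric] measure_pmf.integrable_const_bound[where B = 1])
      (auto simp: utility_def)
  also have "\<dots> \<le> (\<integral>\<^sup>+h'. potential n P a p h' \<partial>?M)"
    using consistent_run[OF assms(1)] utility_le_potential[OF _ assms(2)]
    by (intro nn_integral_mono_AE) (auto simp: AE_measure_pmf_iff intro!: ennreal_leI simp del: fun_upd_apply)
  also have "\<dots> \<le> ennreal (potential n P a p h)" by (rule nn_integral_potential_run)
  finally show ?thesis by (simp add: potential_bounds)
qed

section \<open>Honest executions\<close>

definition walk :: "nat \<Rightarrow> bool \<Rightarrow> nat \<Rightarrow> nat \<Rightarrow> nat" where
  "walk n d k = (\<lambda>i. neighbour n i d) ^^ k"

lemma walk_0 [simp]: "walk n d 0 i = i"
  and walk_Suc: "walk n d (Suc k) i = neighbour n (walk n d k i) d"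
  and walk_Suc_right: "walk n d (Suc k) i = walk n d k (neighbour n i d)"
  and walk_add: "walk n d (k + l) i = walk n d k (walk n d l i)"
  by (simp_all add: walk_def funpow_swap1[of "\<lambda>i. neighbour n i d"] funpow_add)

lemma walk_less: "i < n \<Longrightarrow> walk n d k i < n"
  by (induction k) (simp_all add: walk_Suc neighbour_less)

lemma walk_walk:
  assumes "i < n" shows "walk n (\<not> d) k (walk n d k i) = i"
proof (induction k)
  case (Suc k)
  then show ?case
    using neighbour_neighbour[OF walk_less[OF assms], of d k d]
    unfolding walk_Suc_right[of n "\<not> d"] unfolding walk_Suc[of n d] by simp
qed simp

lemma walk_True: "i < n \<Longrightarrow> walk n True k i = (i + k) mod n"
  by (induction k) (simp_all add: walk_Suc neighbour_def mod_Suc_eq)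

lemma walk_eq_self_iff:
  assumes "i < n" shows "walk n d k i = i \<longleftrightarrow> n dvd k"
proof -
  have "walk n True k i = i \<longleftrightarrow> n dvd k"
    using mod_eq_dvd_iff_nat[of i "i + k" n] assms by (simp add: walk_True)
  moreover have "walk n False k i = i \<longleftrightarrow> walk n True k i = i"
    using walk_walk[OF assms, of False k] walk_walk[OF assms, of True k] by auto
  ultimately show ?thesis by (cases d) auto
qed

lemma walk_inj:
  assumes "i < n" "k < n" "l < n" "walk n d k i = walk n d l i" shows "k = l"
proof -
  have *: "l = k" if "k \<le> l" "l < n" "walk n d k i = walk n d l i" for k l
  proof -
    have "walk n d (l - k) (walk n d k i) = walk n d k i"
      using walk_add[of n d "l - k" k i] that by simp
    then have "n dvd l - k" using walk_eq_self_iff[OF walk_less[OF assms(1)]] by blast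
    then show ?thesis using that by (auto dest: dvd_imp_le)
  qed
  show ?thesis
    using *[OF _ assms(3,4)] *[OF _ assms(2) assms(4)[symmetric]] linear[of k l] by blast
qed

lemma walk_surj:
  assumes "i < n" "j < n" shows "\<exists>k<n. walk n d k i = j"
proof -
  have "inj_on (\<lambda>k. walk n d k i) {..<n}" using walk_inj[OF assms(1)] by (auto intro: inj_onI)
  moreover have "(\<lambda>k. walk n d k i) ` {..<n} \<subseteq> {..<n}" using walk_less[OF assms(1)] by auto
  ultimately have "(\<lambda>k. walk n d k i) ` {..<n} = {..<n}" by (intro endo_inj_surj) auto
  then show ?thesis using assms(2) by (metis (no_types, lifting) imageE lessThan_iff)
qed

lemma peer_port_direction: "(peer_port n P i q = P (across n P i q)) \<longleftrightarrow> (q \<noteq> P i)"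
  by (auto simp: peer_port_def)

section \<open>Election and movement of the token\<close>

locale honest_ring =
  fixes n :: nat and P :: "nat \<Rightarrow> port" and x :: "nat \<Rightarrow> priv" and leader :: nat
  assumes even_n: "even n" and n_pos: "0 < n"
    and inj: "inj_on (fst \<circ> x) {..<n}"
    and leader: "leader < n" "\<And>i. i < n \<Longrightarrow> fst (x leader) \<le> fst (x i)"
begin

abbreviation ident :: "nat \<Rightarrow> nat" where "ident i \<equiv> fst (x i)"
text \<open>The direction of the token: the leader accepts its id at port \<open>False\<close> and
  sends the token through port \<open>True\<close>, which is clockwise iff
  \<open>P leader\<close>.\<close>

abbreviation dir :: bool where "dir \<equiv> P leader"
abbreviation node :: "nat \<Rightarrow> nat" where "node k \<equiv> walk n dir k leader"

lemma ident_eqD: "ident i = ident j \<Longrightarrow> i < n \<Longrightarrow> j < n \<Longrightarrow> i = j"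
  using inj by (auto simp: inj_on_def)

text \<open>The id that agent \<open>i\<close> sends in direction \<open>d\<close> in round \<open>T\<close> has travelled \<open>T\<close> edges.\<close>

definition candidate_at :: "nat \<Rightarrow> nat \<Rightarrow> bool \<Rightarrow> nat option" where
  "candidate_at T i d =
     (if \<forall>s<T. ident (walk n (\<not> d) T i) < ident (walk n (\<not> d) s i)
      then Some (ident (walk n (\<not> d) T i)) else None)"

text \<open>Here \<open>d\<close> is the direction from which the token arrives.\<close>

definition arrival_at :: "nat \<Rightarrow> nat \<Rightarrow> bool \<Rightarrow> bool option" where
  "arrival_at T i d =
     (if n \<le> T \<and> i = node (T - n) \<and> d \<noteq> dir then Some (odd (T - n)) else None)"

lemma candidate_at_Suc:
  "candidate_at (Suc T) i d = (case candidate_at T (neighbour n i (\<not> d)) d of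
     Some j \<Rightarrow> if j < ident i then Some j else None | None \<Rightarrow> None)"
  by (auto simp: candidate_at_def walk_Suc_right[symmetric] less_Suc_eq_0_disj)

text \<open>An id that returns has travelled a multiple of \<open>n\<close> edges. The comparison is
  strict, so it cannot pass its own owner and the tour is the first one; having passed all others,
  it is the smallest. Conversely, ids being distinct, the smallest one meets only larger
  ones.\<close>

lemma candidate_returns_iff:
  assumes i: "i < n"
  shows "candidate_at T (neighbour n i d) (\<not> d) = Some (ident i) \<longleftrightarrow> Suc T = n \<and> i = leader"
proof
  assume "candidate_at T (neighbour n i d) (\<not> d) = Some (ident i)"
  then have w: "ident (walk n d (Suc T) i) = ident i"
    and less: "\<And>s. s < T \<Longrightarrow> ident i < ident (walk n d (Suc s) i)"
    by (auto simp: candidate_at_def walk_Suc_right split: if_splits)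
  have "walk n d (Suc T) i = i" using ident_eqD[OF w] i by (simp add: walk_less)
  then have dvd: "n dvd Suc T" using walk_eq_self_iff[OF i] by blast
  have T: "Suc T = n"
  proof (rule ccontr)
    assume "Suc T \<noteq> n"
    then have "n - 1 < T" using dvd n_pos by (auto dest!: dvd_imp_le)
    then show False using less[of "n - 1"] walk_eq_self_iff[OF i, of d n] n_pos by simp
  qed
  obtain k where k: "k < n" "walk n d k i = leader" using walk_surj[OF i leader(1)] by blast
  have "i = leader"
  proof (cases k)
    case 0
    then show ?thesis using k by simp
  next
    case (Suc s)
    then show ?thesis using less[of s] k leader(2)[OF i] T by simp
  qed
  with T show "Suc T = n \<and> i = leader" by simp
next
  assume *: "Suc T = n \<and> i = leader"
  then have w: "walk n d (Suc T) i = i" using walk_eq_self_iff[OF i, of d "Suc T"] by simp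
  have "ident i < ident (walk n d (Suc s) i)" if "s < T" for s
  proof -
    have "\<not> n dvd Suc s" using that * by (auto dest: dvd_imp_le)
    then have "walk n d (Suc s) i \<noteq> i" using walk_eq_self_iff[OF i] by blast
    then have "ident (walk n d (Suc s) i) \<noteq> ident i"
      using ident_eqD[of "walk n d (Suc s) i" i] i walk_less[OF i] by blast
    moreover have "ident i \<le> ident (walk n d (Suc s) i)" using leader(2) walk_less[OF i] * by blast
    ultimately show ?thesis by simp
  qed
  then show "candidate_at T (neighbour n i d) (\<not> d) = Some (ident i)"
    using w by (auto simp: candidate_at_def walk_Suc_right)
qed

text \<open>The condition \<open>d \<noteq> P i\<close> is the test for port \<open>False\<close> in
  \<open>arrival\<close>, told in directions. The token appears at the leader at time
  \<open>n\<close> and then moves one node along \<open>dir\<close> per round.\<close>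

lemma arrival_at_Suc:
  assumes i: "i < n"
  shows "arrival_at (Suc T) i d =
    (if d \<noteq> P i \<and> candidate_at T (neighbour n i d) (\<not> d) = Some (ident i) then Some False
     else map_option Not (arrival_at T (neighbour n i d) d))"
proof -
  have iff: "neighbour n i d = node k \<longleftrightarrow> i = node (Suc k)" if "d \<noteq> dir" for k
  proof -
    have "d = (\<not> dir)" using that by blast
    then show ?thesis
      using neighbour_neighbour[OF i, of d] neighbour_neighbour[of "node k" n dir] walk_less[OF leader(1)]
      by (auto simp: walk_Suc)
  qed
  show ?thesis
    unfolding candidate_returns_iff[OF i]
  proof (cases "d = dir")
    case True
    then show "arrival_at (Suc T) i d = (if d \<noteq> P i \<and> Suc T = n \<and> i = leader then Some False
        else map_option Not (arrival_at T (neighbour n i d) d))"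
      by (auto simp: arrival_at_def)
  next
    case False
    consider "Suc T < n" | "Suc T = n" | "n \<le> T" by linarith
    then show "arrival_at (Suc T) i d = (if d \<noteq> P i \<and> Suc T = n \<and> i = leader then Some False
        else map_option Not (arrival_at T (neighbour n i d) d))"
    proof cases
      case 1
      then show ?thesis by (simp add: arrival_at_def)
    next
      case 2
      then have "\<not> n \<le> T" by simp
      then show ?thesis using 2 False by (cases "i = leader") (simp_all add: arrival_at_def)
    next
      case 3
      then have "Suc T - n = Suc (T - n)" "Suc T \<noteq> n" by simp_all
      then show ?thesis using 3 False iff[OF False, of "T - n"] by (simp add: arrival_at_def)
    qed
  qed
qed

text \<open>On its first tour the token is at \<open>node k\<close> at time \<open>n + k\<close>.
  Hence nodes \<open>2 * j\<close> and \<open>2 * j + 1\<close> send their coins in round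
  \<open>n + 2 * j + 1\<close>, which is on record one round later. Arrivals of the previous round
  are tracked because initiators act on them.\<close>

definition on_schedule :: "nat \<Rightarrow> (nat \<Rightarrow> history) \<Rightarrow> bool" where
  "on_schedule T h \<longleftrightarrow>
     (\<forall>i<n. \<forall>q. relay_candidate (ident i) (h i) q = candidate_at T i (q = P i)
        \<and> arrival (ident i) (h i) q = arrival_at T i (q = P i)
        \<and> arrival (ident i) (tl (h i)) q = arrival_at (T - 1) i (q = P i)) \<and>
     (\<forall>k<n. if n + 2 * (k div 2) + 2 \<le> T then \<exists>q g. engaged (h (node k)) = Some (q, Some g)
            else engaged (h (node k)) = None)"

lemma on_schedule_engaged:
  assumes "on_schedule T h" "k < n"
  shows "n + 2 * (k div 2) + 2 \<le> T \<Longrightarrow> \<exists>q g. engaged (h (node k)) = Some (q, Some g)"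
    and "T < n + 2 * (k div 2) + 2 \<Longrightarrow> engaged (h (node k)) = None"
proof -
  have "if n + 2 * (k div 2) + 2 \<le> T then \<exists>q g. engaged (h (node k)) = Some (q, Some g)
        else engaged (h (node k)) = None"
    using assms unfolding on_schedule_def by blast
  then show "n + 2 * (k div 2) + 2 \<le> T \<Longrightarrow> \<exists>q g. engaged (h (node k)) = Some (q, Some g)"
    and "T < n + 2 * (k div 2) + 2 \<Longrightarrow> engaged (h (node k)) = None"
    by (simp_all split: if_splits)
qed

lemma on_schedule_0: "on_schedule 0 (\<lambda>_. [])"
  using n_pos by (simp add: on_schedule_def relay_candidate_def candidate_at_def arrival_at_def)

section \<open>Pairs of adjacent nodes and their exchanges\<close>

definition mate_dir :: "nat \<Rightarrow> bool" where "mate_dir k = (if even k then dir else \<not> dir)"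
definition mate :: "nat \<Rightarrow> nat" where "mate k = (if even k then k + 1 else k - 1)"

text \<open>Since \<open>n\<close> is even, the last node is the second of its pair, so every node
  has a mate below \<open>n\<close>.\<close>

lemma mate:
  assumes "k < n"
  shows "mate k < n" "mate k div 2 = k div 2" "even (mate k) = odd k"
    "mate_dir (mate k) = (\<not> mate_dir k)" "neighbour n (node k) (mate_dir k) = node (mate k)"
proof -
  show "mate k < n" using assms even_n by (auto simp: mate_def less_imp_diff_less) presburger
  show "mate k div 2 = k div 2" by (auto simp: mate_def elim!: oddE)
  show "even (mate k) = odd k" by (auto simp: mate_def)
  then show "mate_dir (mate k) = (\<not> mate_dir k)" by (simp add: mate_dir_def)
  show "neighbour n (node k) (mate_dir k) = node (mate k)"
  proof (cases "even k")
    case True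
    then show ?thesis by (simp add: mate_def mate_dir_def walk_Suc)
  next
    case False
    then obtain l where "k = Suc l" by (cases k) auto
    then show ?thesis
      using False neighbour_neighbour[OF walk_less[OF leader(1)], of dir l dir]
      by (simp add: mate_def mate_dir_def walk_Suc)
  qed
qed

text \<open>Until the exchange of its pair a node sees only the first tour of the token, so
  \<open>walk_inj\<close> recovers the index of the node from the position of the token.\<close>

lemma engagement_on_schedule:
  assumes h: "on_schedule T h" and k: "k < n" and T: "T < n + 2 * (k div 2) + 2"
  shows "engagement (ident (node k)) (h (node k)) =
    (if T = n + 2 * (k div 2) + 1 then Some (mate_dir k = P (node k), even k) else None)"
proof -
  have v: "node k < n" by (rule walk_less[OF leader(1)])
  have none: "engaged (h (node k)) = None" by (rule on_schedule_engaged(2)[OF h k T])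
  have a: "arrival (ident (node k)) (h (node k)) q = arrival_at T (node k) (q = P (node k))"
    and a': "arrival (ident (node k)) (tl (h (node k))) q = arrival_at (T - 1) (node k) (q = P (node k))" for q
    using h v by (auto simp: on_schedule_def)
  obtain N where N: "n = 2 * N" using even_n by (elim evenE)
  have "2 * (k div 2) \<le> k" by simp
  then have "k div 2 < N" using k N by linarith
  then have le_n: "2 * (k div 2) + 2 \<le> n" using N by linarith
  have odd_k: "odd k \<Longrightarrow> 2 * (k div 2) + 1 = k" and even_k: "even k \<Longrightarrow> 2 * (k div 2) = k"
    by (simp_all add: odd_two_times_div_two_succ)
  have respond: "arrival_at T (node k) d = Some True \<longleftrightarrow> odd k \<and> T = n + 2 * (k div 2) + 1 \<and> d \<noteq> dir" for d
  proof
    assume "arrival_at T (node k) d = Some True"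
    then have 1: "n \<le> T" "node k = node (T - n)" "odd (T - n)" "d \<noteq> dir"
      by (auto simp: arrival_at_def split: if_splits)
    have "T - n < n" using T le_n by linarith
    then have eq: "k = T - n" using walk_inj[OF leader(1) k _ 1(2)] by blast
    then have "odd k" using 1(3) by simp
    then show "odd k \<and> T = n + 2 * (k div 2) + 1 \<and> d \<noteq> dir" using 1 odd_k eq by linarith
  next
    assume *: "odd k \<and> T = n + 2 * (k div 2) + 1 \<and> d \<noteq> dir"
    then have "T = n + k" using odd_k by linarith
    then show "arrival_at T (node k) d = Some True" using * by (auto simp: arrival_at_def)
  qed
  \<comment> \<open>The initiator looks back one round, to \<open>T - 1 = n + k\<close>, and so acts
    in the same round as its mate.\<close>
  have initiate: "arrival_at (T - 1) (node k) d = Some False \<longleftrightarrow> even k \<and> T = n + 2 * (k div 2) + 1 \<and> d \<noteq> dir" for d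
  proof
    assume "arrival_at (T - 1) (node k) d = Some False"
    then have 1: "n \<le> T - 1" "node k = node (T - 1 - n)" "even (T - 1 - n)" "d \<noteq> dir"
      by (auto simp: arrival_at_def split: if_splits)
    have "T - 1 - n < n" using T le_n by linarith
    then have eq: "k = T - 1 - n" using walk_inj[OF leader(1) k _ 1(2)] by blast
    then have "even k" using 1(3) by simp
    then show "even k \<and> T = n + 2 * (k div 2) + 1 \<and> d \<noteq> dir" using 1 n_pos even_k eq by linarith
  next
    assume *: "even k \<and> T = n + 2 * (k div 2) + 1 \<and> d \<noteq> dir"
    then have "T = n + k + 1" using even_k by linarith
    then show "arrival_at (T - 1) (node k) d = Some False" using * by (auto simp: arrival_at_def)
  qed
  have ex: "\<exists>p. (p = P (node k)) \<noteq> dir" by (cases dir; cases "P (node k)") auto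
  define t where "t \<longleftrightarrow> T = n + 2 * (k div 2) + 1"
  have some: "(\<exists>p. odd k \<and> t \<and> (p = P (node k)) \<noteq> dir) \<longleftrightarrow> odd k \<and> t"
      "(\<exists>p. even k \<and> t \<and> (p = P (node k)) \<noteq> dir) \<longleftrightarrow> even k \<and> t"
    using ex by blast+
  \<comment> \<open>\<open>d = P i\<close> is the port of \<open>i\<close> in direction
    \<open>d\<close>: the responder sends against \<open>dir\<close>, the initiator along
    it.\<close>
  have port: "((True = P (node k)) \<noteq> dir) = ((\<not> dir) = P (node k))" by blast
  show ?thesis
    unfolding engagement_def a a' respond initiate mate_dir_def t_def[symmetric] some port none
    by (cases t; cases "even k") (simp_all only: simp_thms if_True if_False not_not not_False_eq_True; blast)+
qed

text \<open>Mates engage with each other in the same round and with opposite roles, so the exchange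
  succeeds whatever bits are drawn.\<close>

lemma on_schedule_step:
  assumes h: "on_schedule T h" and h': "h' \<in> set_pmf (ring_round n P (\<lambda>_. protocol) x h)"
  shows "on_schedule (Suc T) h'"
proof -
  from h' obtain acts where acts: "\<forall>i<n. acts i \<in> set_pmf (protocol (x i) (h i))"
    and h'_eq: "h' = (\<lambda>i. if i < n then (acts i, received n P acts i) # h i else [])"
    by (rule set_ring_round)
  have "\<exists>b. acts i = honest_step (ident i) (h i) b" if "i < n" for i
    using acts that by (auto simp: set_pmf_protocol)
  then obtain b where b: "\<And>i. i < n \<Longrightarrow> acts i = honest_step (ident i) (h i) (b i)" by metis
  have dirs: "(peer_port n P i q = P (across n P i q)) = (q \<noteq> P i)"
      "neighbour n i (q = P i) = across n P i q" for i q
    by (rule peer_port_direction) (simp add: across_def)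
  have rc: "relay_candidate (ident i) (h i) q = candidate_at T i (q = P i)"
    and ar: "arrival (ident i) (h i) q = arrival_at T i (q = P i)" if "i < n" for i q
    using h that by (auto simp: on_schedule_def)
  have received_candidate: "candidate (received n P acts i q) = candidate_at T (neighbour n i (q = P i)) (q \<noteq> P i)"
    if "i < n" for i q
    using that by (simp add: received_eq b across_less rc dirs)
  have received_token: "token (received n P acts i q) = map_option Not (arrival_at T (neighbour n i (q = P i)) (q = P i))"
    if "i < n" for i q
  proof -
    have "((\<not> peer_port n P i q) = P (across n P i q)) = (q = P i)" using dirs(1)[of i q] by blast
    then show ?thesis using that by (simp add: received_eq b across_less relay_token_def ar dirs(2))
  qed
  show ?thesis
    unfolding on_schedule_def
  proof (intro conjI allI impI)
    fix i q assume i: "i < n"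
    have "(\<not> q) = P i \<longleftrightarrow> \<not> (q = P i)" by blast
    then show "relay_candidate (ident i) (h' i) q = candidate_at (Suc T) i (q = P i)"
      using i by (simp add: h'_eq relay_candidate_def received_candidate candidate_at_Suc)
    show "arrival (ident i) (h' i) q = arrival_at (Suc T) i (q = P i)"
      using i by (auto simp: h'_eq received_candidate received_token arrival_at_Suc)
    show "arrival (ident i) (tl (h' i)) q = arrival_at (Suc T - 1) i (q = P i)"
      using i by (simp add: h'_eq ar)
  next
    fix k assume k: "k < n"
    have v: "node j < n" for j by (rule walk_less[OF leader(1)])
    have eng: "engaged (h' (node k)) = (case engaged (h (node k)) of Some z \<Rightarrow> Some z | None \<Rightarrow>
        map_option (\<lambda>(q, r). (q, exchange (Some (r, b (node k))) (coin (received n P acts (node k) q))))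
          (engagement (ident (node k)) (h (node k))))"
      using v by (simp add: h'_eq b engaged_honest_step)
    show "if n + 2 * (k div 2) + 2 \<le> Suc T then \<exists>q g. engaged (h' (node k)) = Some (q, Some g)
            else engaged (h' (node k)) = None"
    proof (cases "n + 2 * (k div 2) + 2 \<le> T")
      case True
      then obtain q g where "engaged (h (node k)) = Some (q, Some g)"
        using on_schedule_engaged(1)[OF h k] by blast
      then show ?thesis using True v eng by simp
    next
      case False
      then have T: "T < n + 2 * (k div 2) + 2" by simp
      have none: "engaged (h (node k)) = None" by (rule on_schedule_engaged(2)[OF h k T])
      show ?thesis
      proof (cases "T = n + 2 * (k div 2) + 1")
        case False
        then show ?thesis using T eng none engagement_on_schedule[OF h k T] by simp
      next
        case True
        let ?q = "mate_dir k = P (node k)"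
        note m = mate[OF k]
        have e: "engagement (ident (node k)) (h (node k)) = Some (?q, even k)"
          using engagement_on_schedule[OF h k T] True by simp
        have e': "engagement (ident (node (mate k))) (h (node (mate k)))
            = Some (mate_dir (mate k) = P (node (mate k)), even (mate k))"
          using engagement_on_schedule[OF h m(1)] T True m(2) by simp
        have ac: "across n P (node k) ?q = node (mate k)"
          using m(5) by (cases "P (node k)") (simp_all add: across_def)
        have "(peer_port n P (node k) ?q) = (mate_dir (mate k) = P (node (mate k)))"
          using m(4) by (auto simp: peer_port_def ac)
        then have "coin (received n P acts (node k) ?q) = Some (even (mate k), b (node (mate k)))"
          by (simp add: received_eq ac b v coin_at_def e')
        then show ?thesis using True eng none e m(3) by (auto simp: exchange_def)
      qed
    qed
  qed
qed

section \<open>Legality of honest executions\<close>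

lemma on_schedule_run:
  "h \<in> set_pmf (run n P (\<lambda>_. protocol) x T (\<lambda>_. [])) \<Longrightarrow> on_schedule T h"
  by (induction T arbitrary: h) (auto simp: on_schedule_0 intro: on_schedule_step)

text \<open>Honest play is the deviation of \<open>a\<close> to \<open>protocol\<close>
  itself.\<close>

lemma consistent_honest_run:
  assumes "h \<in> set_pmf (run n P (\<lambda>_. protocol) x T (\<lambda>_. []))"
  shows "consistent n P a h"
proof (rule consistent_run)
  show "consistent n P a (\<lambda>_. [])" by (simp add: consistent_def)
  show "h \<in> set_pmf (run n P ((\<lambda>_. protocol)(a := protocol)) x T (\<lambda>_. []))"
    using assms by (simp add: fun_upd_idem)
qed

text \<open>With \<open>n\<close> in the place of the deviator there are no captives, so the groups
  balance. By the timetable every agent has a result after at most \<open>2 * n + 2\<close> rounds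
  and has output it one round later.\<close>

lemma legal_run:
  assumes h': "h' \<in> set_pmf (run n P (\<lambda>_. protocol) x T (\<lambda>_. []))" and T: "2 * n + 3 \<le> T"
  shows "legal n (\<lambda>i. final_output (h' i))"
proof -
  obtain T' where T': "T = Suc T'" "2 * n + 2 \<le> T'" using T by (cases T) auto
  obtain h where h: "h \<in> set_pmf (run n P (\<lambda>_. protocol) x T' (\<lambda>_. []))"
    and step: "h' \<in> set_pmf (ring_round n P (\<lambda>_. protocol) x h)"
    using h' by (auto simp: T')
  obtain acts where acts: "\<forall>i<n. acts i \<in> set_pmf (protocol (x i) (h i))"
    and h'_eq: "h' = (\<lambda>i. if i < n then (acts i, received n P acts i) # h i else [])"
    using step by (rule set_ring_round)
  have cons: "consistent n P n h'" by (rule consistent_honest_run[OF h'])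
  have res: "\<exists>g. result (h i) = Some g" if i: "i < n" for i
  proof -
    obtain k where k: "k < n" "node k = i" using walk_surj[OF leader(1) i, of dir] by blast
    have "2 * (k div 2) \<le> k" by simp
    then have le: "n + 2 * (k div 2) + 2 \<le> T'" using T'(2) k(1) by linarith
    show ?thesis
      using on_schedule_engaged(1)[OF on_schedule_run[OF h] k(1) le] k(2)
      by (auto simp: result_eq_Some_iff)
  qed
  have out: "final_output (h' i) = result (h' i)" "\<exists>g. result (h' i) = Some g" if i: "i < n" for i
  proof -
    obtain g where g: "result (h i) = Some g" using res[OF i] by blast
    obtain b where b: "acts i = honest_step (ident i) (h i) b"
      using acts i by (auto simp: set_pmf_protocol)
    have "committed (h' i) \<noteq> None"
      using i by (cases "committed (h i)") (simp_all add: h'_eq b g)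
    then obtain d where d: "committed (h' i) = Some d" by blast
    have "d \<noteq> None \<and> result (h' i) = d" using cons i d unfolding consistent_def by blast
    then show "final_output (h' i) = result (h' i)" "\<exists>g. result (h' i) = Some g"
      using d by (auto simp: final_output_def)
  qed
  have eq: "{i. i < n \<and> final_output (h' i) = Some g} = assigned n n h' g" for g
    using out(1) by (auto simp: assigned_def)
  have "across n P i q \<noteq> n" if "i < n" for i q using across_less[OF that, of P q] by simp
  then have "captives n P n h' = {}" by (auto simp: captives_def)
  then have same: "card (assigned n n h' g) = card (assigned n n h' (\<not> g))" for g
    using card_assigned[OF cons, of g] by simp
  have half: "2 * card (assigned n n h' g) = n" for g
  proof -
    have "i \<in> assigned n n h' g \<union> assigned n n h' (\<not> g)" if i: "i < n" for i
    proof -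
      obtain g' where "result (h' i) = Some g'" using out(2)[OF i] by blast
      then show ?thesis using i by (cases "g' = g") (auto simp: assigned_def)
    qed
    moreover have "assigned n n h' b \<subseteq> {..<n}" for b unfolding assigned_def by blast
    ultimately have un: "assigned n n h' g \<union> assigned n n h' (\<not> g) = {..<n}" by blast
    have "assigned n n h' g \<inter> assigned n n h' (\<not> g) = {}" by (auto simp: assigned_def)
    then have "card (assigned n n h' g \<union> assigned n n h' (\<not> g)) =
        card (assigned n n h' g) + card (assigned n n h' (\<not> g))"
      by (intro card_Un_disjoint) simp_all
    then show ?thesis using same[of g] unfolding un by simp
  qed
  show ?thesis unfolding legal_def eq by (intro allI half)
qed

end

section \<open>Equilibrium\<close>

lemma run_add: "run n P S x (r + T) h = bind_pmf (run n P S x r h) (run n P S x T)"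
  by (induction T) (simp_all add: bind_return_pmf' bind_assoc_pmf)

lemma finite_private_infos: "finite I \<Longrightarrow> finite (private_infos n I)"
  by (rule finite_subset[OF _ finite_PiE[of "{..<n}" "\<lambda>_. I \<times> UNIV"]])
    (auto simp: private_infos_def)

lemma private_infos_nonempty:
  assumes "finite I" "n \<le> card I" shows "private_infos n I \<noteq> {}"
proof -
  obtain f where f: "f ` {..<n} \<subseteq> I" "inj_on f {..<n}"
    using card_le_inj[of "{..<n}" I] assms by auto
  have "(\<lambda>i\<in>{..<n}. (f i, False)) \<in> private_infos n I"
    using f by (auto simp: private_infos_def inj_on_def)
  then show ?thesis by blast
qed

lemma honest_ring_of_private_infos:
  assumes "even n" "0 < n" "x \<in> private_infos n I"
  shows "\<exists>leader. honest_ring n x leader"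
proof -
  obtain leader where "leader < n" "\<forall>i. i < n \<longrightarrow> fst (x leader) \<le> fst (x i)"
    using ex_has_least_nat[of "\<lambda>i. i < n" 0 "\<lambda>i. fst (x i)"] assms(2) by auto
  then show ?thesis
    using assms by (intro exI[of _ leader]) (auto simp: honest_ring_def private_infos_def)
qed

lemma utility_bounds: "0 \<le> utility n i p out" "utility n i p out \<le> 1"
  by (auto simp: utility_def)

lemma integrable_utility: "integrable (measure_pmf M) (\<lambda>z. utility (n z) (i z) (p z) (out z))"
  by (rule measure_pmf.integrable_const_bound[where B = 1]) (auto simp: utility_def)

text \<open>In a legal outcome an agent gets one of its two groups, so the upper bound for the
  other group is a lower bound for this one.\<close>

lemma expectation_utility_ge:
  assumes ring: "even n" "0 < n" "x \<in> private_infos n I" and a: "a < n"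
    and h: "h \<in> set_pmf (run n P (\<lambda>_. protocol) x r (\<lambda>_. []))" and T: "2 * n + 3 \<le> T"
  shows "potential n P a p h \<le> measure_pmf.expectation (run n P (\<lambda>_. protocol) x T h)
           (\<lambda>h'. utility n a p (\<lambda>i. final_output (h' i)))"
proof -
  obtain leader where "honest_ring n x leader" using honest_ring_of_private_infos[OF ring] by blast
  then interpret honest_ring n P x leader .
  let ?M = "measure_pmf (run n P (\<lambda>_. protocol) x T h)"
  let ?u = "\<lambda>p h'. utility n a p (\<lambda>i. final_output (h' i))"
  have sum: "?u p h' + ?u (\<not> p) h' = 1" if "h' \<in> set_pmf (run n P (\<lambda>_. protocol) x T h)" for h'
  proof -
    \<comment> \<open>Continuing from \<open>h\<close> is itself an honest execution from the start,
      of \<open>r + T\<close> rounds.\<close>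
    have "h' \<in> set_pmf (run n P (\<lambda>_. protocol) x (r + T) (\<lambda>_. []))"
      using h that by (auto simp: run_add)
    then have legal: "legal n (\<lambda>i. final_output (h' i))"
      by (rule legal_run) (use T in simp)
    define Q where "Q g = {i. i < n \<and> final_output (h' i) = Some g}" for g
    have "2 * card (Q g) = n" for g using legal by (simp add: legal_def Q_def)
    moreover have "finite (Q g)" for g by (simp add: Q_def)
    moreover have "Q p \<inter> Q (\<not> p) = {}" by (auto simp: Q_def)
    ultimately have "card (Q p \<union> Q (\<not> p)) = card {..<n}"
      by (metis card_Un_disjoint card_lessThan mult_2 nat_mult_eq_cancel1 zero_less_numeral)
    then have "Q p \<union> Q (\<not> p) = {..<n}" by (intro card_subset_eq) (auto simp: Q_def)
    then have "a \<in> Q p \<union> Q (\<not> p)" using a by simp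
    then show ?thesis using legal by (auto simp: Q_def utility_def)
  qed
  have "(\<integral>h'. ?u p h' \<partial>?M) + (\<integral>h'. ?u (\<not> p) h' \<partial>?M) = (\<integral>h'. ?u p h' + ?u (\<not> p) h' \<partial>?M)"
    by (intro Bochner_Integration.integral_add[symmetric] integrable_utility)
  also have "\<dots> = (\<integral>h'. 1 \<partial>?M)"
    by (intro integral_cong_AE) (auto simp: AE_measure_pmf_iff sum)
  finally have "(\<integral>h'. ?u p h' \<partial>?M) + (\<integral>h'. ?u (\<not> p) h' \<partial>?M) = 1" by simp
  moreover have "(\<integral>h'. ?u (\<not> p) h' \<partial>?M) \<le> potential n P a (\<not> p) h"
    using expectation_utility_le[OF consistent_honest_run[OF h] a, of protocol x T "\<not> p"]
    by (simp add: fun_upd_idem)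
  ultimately show ?thesis using potential_add_potential[of n P a p h] by linarith
qed

lemma solves_protocol:
  assumes "\<forall>n\<in>set_pmf \<sigma>. even n \<and> 0 < n"
  shows "solves_ring_partition \<sigma> I P protocol"
  unfolding solves_ring_partition_def
proof (intro ballI)
  fix n x assume "n \<in> set_pmf \<sigma>" "x \<in> private_infos n (I n)"
  then obtain leader where "honest_ring n x leader"
    using honest_ring_of_private_infos assms by blast
  then interpret honest_ring n "P n" x leader .
  show "\<exists>T. \<forall>h\<in>set_pmf (run n (P n) (\<lambda>_. protocol) x T (\<lambda>_. [])). legal n (\<lambda>i. final_output (h i))"
    using legal_run by blast
qed

text \<open>The law of total expectation for infinite supports, carried over from nonnegative
  integrals; the bounds supply integrability.\<close>

lemma expectation_bind_pmf:
  fixes f :: "_ \<Rightarrow> real"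
  assumes "\<And>z. 0 \<le> f z" "\<And>z. f z \<le> 1"
  shows "measure_pmf.expectation (bind_pmf M N) f
    = measure_pmf.expectation M (\<lambda>z. measure_pmf.expectation (N z) f)"
proof -
  have int: "integrable (measure_pmf K) f" for K
    by (rule measure_pmf.integrable_const_bound[where B = 1]) (use assms in auto)
  have bounds: "0 \<le> measure_pmf.expectation K f" "measure_pmf.expectation K f \<le> 1" for K
    using assms by (auto intro!: integral_nonneg_AE measure_pmf.integral_le_const int)
  have eq: "(\<integral>\<^sup>+z. f z \<partial>measure_pmf K) = ennreal (measure_pmf.expectation K f)" for K
    by (rule nn_integral_eq_integral) (use int assms in auto)
  have "ennreal (measure_pmf.expectation (bind_pmf M N) f) = (\<integral>\<^sup>+z. f z \<partial>measure_pmf (bind_pmf M N))"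
    by (rule eq[symmetric])
  also have "\<dots> = (\<integral>\<^sup>+z. ennreal (measure_pmf.expectation (N z) f) \<partial>measure_pmf M)"
    unfolding nn_integral_bind_pmf by (simp only: eq)
  also have "\<dots> = ennreal (measure_pmf.expectation M (\<lambda>z. measure_pmf.expectation (N z) f))"
    by (rule nn_integral_eq_integral)
      (use bounds in \<open>auto intro!: measure_pmf.integrable_const_bound[where B = 1]\<close>)
  finally show ?thesis using bounds by (simp add: integral_nonneg_AE)
qed

text \<open>State by state, \<open>V\<close> bounds what any \<open>\<delta>\<close> can reach, and
  honest play reaches it once the ring has finished. Averaging over the belief preserves both,
  whatever its weights.\<close>

lemma equilibrium_protocol:
  assumes \<sigma>: "\<forall>n\<in>set_pmf \<sigma>. even n \<and> 0 < n \<and> finite (I n) \<and> n \<le> card (I n)"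
  shows "is_equilibrium \<sigma> I P protocol"
  unfolding is_equilibrium_def
proof (intro allI impI ballI)
  fix a r w \<delta>
  assume a: "\<forall>n\<in>set_pmf \<sigma>. a n < n"
    and w: "w \<in> local_view a ` set_pmf (executions \<sigma> I P protocol r)"
  define B where "B = belief \<sigma> I P protocol a r w"
  define V where "V = (\<lambda>(n, x :: nat \<Rightarrow> priv, h). potential n (P n) (a n) (snd (x (a n))) h)"
  define U where "U \<delta> T = (\<lambda>(n, x, h). measure_pmf.expectation
      (run n (P n) ((\<lambda>_. protocol)(a n := \<delta>)) x T h)
      (\<lambda>h'. utility n (a n) (snd (x (a n))) (\<lambda>i. final_output (h' i))))" for \<delta> T
  \<comment> \<open>\<open>w\<close> arises in some execution, so conditioning on it is well defined
    and the belief is supported on honest executions.\<close>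
  have B: "n \<in> set_pmf \<sigma> \<and> x \<in> private_infos n (I n) \<and>
      h \<in> set_pmf (run n (P n) (\<lambda>_. protocol) x r (\<lambda>_. []))" if "(n, x, h) \<in> set_pmf B" for n x h
  proof -
    have "set_pmf (executions \<sigma> I P protocol r) \<inter> {e. local_view a e = w} \<noteq> {}" using w by auto
    then have "(n, x, h) \<in> set_pmf (executions \<sigma> I P protocol r)"
      using that by (auto simp: B_def belief_def set_cond_pmf)
    then show ?thesis
      using \<sigma> by (auto simp: executions_def finite_private_infos private_infos_nonempty)
  qed
  have U_bounds: "0 \<le> U \<delta> T e" "U \<delta> T e \<le> 1" for \<delta> T e
    by (auto simp: U_def split: prod.split
        intro!: integral_nonneg_AE measure_pmf.integral_le_const integrable_utility utility_bounds)
  have V_bounds: "0 \<le> V e" "V e \<le> 1" for e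
    by (auto simp: V_def potential_bounds split: prod.split)
  have integrable: "integrable (measure_pmf B) f" if "\<And>e. 0 \<le> f e" "\<And>e. f e \<le> 1" for f :: "_ \<Rightarrow> real"
    by (rule measure_pmf.integrable_const_bound[where B = 1]) (use that in auto)
  have expect: "measure_pmf.expectation (utility_after \<sigma> I P protocol a r w \<delta> T) (\<lambda>u. u)
      = measure_pmf.expectation B (U \<delta> T)" for \<delta> T
  proof -
    \<comment> \<open>\<open>expectation_bind_pmf\<close> needs a globally bounded function.\<close>
    define clip where "clip u = max 0 (min 1 u)" for u :: real
    let ?N = "\<lambda>(n, x, h). bind_pmf (run n (P n) ((\<lambda>_. protocol)(a n := \<delta>)) x T h)
        (\<lambda>h'. return_pmf (utility n (a n) (snd (x (a n))) (\<lambda>i. final_output (h' i))))"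
    have after: "utility_after \<sigma> I P protocol a r w \<delta> T = bind_pmf B ?N"
      by (simp add: utility_after_def B_def)
    have "measure_pmf.expectation (bind_pmf B ?N) (\<lambda>u. u) = measure_pmf.expectation (bind_pmf B ?N) clip"
      by (intro integral_cong_AE) (auto simp: AE_measure_pmf_iff clip_def utility_def)
    also have "\<dots> = measure_pmf.expectation B (\<lambda>e. measure_pmf.expectation (?N e) clip)"
      by (rule expectation_bind_pmf) (auto simp: clip_def)
    also have "\<dots> = measure_pmf.expectation B (U \<delta> T)"
      by (intro Bochner_Integration.integral_cong refl)
        (auto simp: U_def clip_def utility_bounds max_absorb2 min_absorb2 map_pmf_def[symmetric]
          simp del: fun_upd_apply split: prod.split)
    finally show ?thesis by (simp only: after)
  qed
  have upper: "measure_pmf.expectation B (U \<delta> T) \<le> measure_pmf.expectation B V" for T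
  proof (rule integral_mono_AE)
    show "AE e in measure_pmf B. U \<delta> T e \<le> V e"
      unfolding AE_measure_pmf_iff
    proof
      fix e assume e: "e \<in> set_pmf B"
      obtain n x h where [simp]: "e = (n, x, h)" by (cases e)
      have n: "n \<in> set_pmf \<sigma>" and x: "x \<in> private_infos n (I n)"
        and h: "h \<in> set_pmf (run n (P n) (\<lambda>_. protocol) x r (\<lambda>_. []))"
        using B e by auto
      obtain leader where "honest_ring n x leader"
        using honest_ring_of_private_infos[OF _ _ x] \<sigma> n by blast
      then interpret honest_ring n "P n" x leader .
      show "U \<delta> T e \<le> V e"
        using expectation_utility_le[OF consistent_honest_run[OF h]] a n
        by (simp add: U_def V_def del: fun_upd_apply)
    qed
  qed (use U_bounds V_bounds in \<open>auto intro!: integrable\<close>)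
  have bdd: "bdd_above (range (\<lambda>T. measure_pmf.expectation B (U protocol T)))"
    by (rule bdd_aboveI[of _ 1])
      (use U_bounds in \<open>auto intro!: measure_pmf.integral_le_const integrable\<close>)
  \<comment> \<open>Rings may be unboundedly large, so in general no single \<open>T\<close> lets
    all of them finish. \<open>L T\<close> keeps \<open>V\<close> on those sure to have finished
    within \<open>T\<close> rounds and converges to \<open>V\<close>.\<close>
  define L where "L T e = (if 2 * fst e + 3 \<le> T then V e else 0)" for T e
  have "measure_pmf.expectation B V \<le> (SUP T. measure_pmf.expectation B (U protocol T))"
  proof (rule LIMSEQ_le_const2)
    show "(\<lambda>T. measure_pmf.expectation B (L T)) \<longlonglongrightarrow> measure_pmf.expectation B V"
    proof (rule integral_dominated_convergence[where w = "\<lambda>_. 1"])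
      show "AE e in measure_pmf B. (\<lambda>T. L T e) \<longlonglongrightarrow> V e"
      proof (rule AE_I2)
        fix e
        have "eventually (\<lambda>T. L T e = V e) sequentially"
          unfolding eventually_sequentially by (rule exI[of _ "2 * fst e + 3"]) (simp add: L_def)
        then show "(\<lambda>T. L T e) \<longlonglongrightarrow> V e" by (rule tendsto_eventually)
      qed
    qed (use V_bounds in \<open>auto simp: L_def\<close>)
    have "measure_pmf.expectation B (L T) \<le> (SUP T. measure_pmf.expectation B (U protocol T))" for T
    proof -
      have "measure_pmf.expectation B (L T) \<le> measure_pmf.expectation B (U protocol T)"
      proof (rule integral_mono_AE)
        show "AE e in measure_pmf B. L T e \<le> U protocol T e"
          unfolding AE_measure_pmf_iff
        proof
          fix e assume e: "e \<in> set_pmf B"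
          obtain n x h where [simp]: "e = (n, x, h)" by (cases e)
          have n: "n \<in> set_pmf \<sigma>" and x: "x \<in> private_infos n (I n)"
            and h: "h \<in> set_pmf (run n (P n) (\<lambda>_. protocol) x r (\<lambda>_. []))"
            using B e by auto
          show "L T e \<le> U protocol T e"
          proof (cases "2 * n + 3 \<le> T")
            case True
            then show ?thesis
              using expectation_utility_ge[OF _ _ x _ h True] \<sigma> a n
              by (simp add: L_def U_def V_def fun_upd_idem)
          qed (use U_bounds in \<open>auto simp: L_def\<close>)
        qed
      qed (use U_bounds V_bounds in \<open>auto simp: L_def intro!: integrable\<close>)
      also have "\<dots> \<le> (SUP T. measure_pmf.expectation B (U protocol T))"
        by (rule cSUP_upper[OF UNIV_I bdd])
      finally show ?thesis .
    qed
    then show "\<exists>N. \<forall>T\<ge>N. measure_pmf.expectation B (L T)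
        \<le> (SUP T. measure_pmf.expectation B (U protocol T))" by blast
  qed
  then show "expected_utility \<sigma> I P protocol a r w \<delta> \<le> expected_utility \<sigma> I P protocol a r w protocol"
    unfolding expected_utility_def expect
    by (intro cSUP_least order_trans[OF upper]) auto
qed

text \<open>\<open>protocol\<close> mentions neither the prior nor the id pools nor the port labels,
  so it can be chosen ahead of them.\<close>

theorem theorem5p5:
  shows "\<exists>\<Lambda> :: strategy.
    \<forall>(\<sigma> :: nat pmf) (I :: nat \<Rightarrow> nat set) (P :: nat \<Rightarrow> nat \<Rightarrow> port).
      (\<forall>n\<in>set_pmf \<sigma>. even n \<and> 0 < n \<and> finite (I n) \<and> n \<le> card (I n)) \<longrightarrow>
      ring_partition_equilibrium \<sigma> I P \<Lambda>"
  unfolding ring_partition_equilibrium_def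
  using solves_protocol equilibrium_protocol by (intro exI[of _ protocol]) blast

end
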